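(* Let $R$ be a commutative noetherian ring. Then the assignment $$P\longmapsto \mathcal{S}_P=\{A\in \mathrm{mod}\text{-}R : \mathrm{Hom}_R(A,E(R/P))=0\}$$ defines a (natural) bijection between $\mathrm{Spec}(R)$ and $\mathrm{Sp}(\mathrm{mod}\text{-}R)$. This bijection is order-reversing if $\mathrm{Spec}(R)$ is ordered by inclusion of prime ideals and $\mathrm{Sp}(\mathrm{mod}\text{-}R)$ by inclusion of Serre subcategories (hence it is order-preserving if $\mathrm{Spec}(R)$ is instead given the specialisation order of the Zariski topology, in which $P\le Q$ iff $P$ lies in the closure of $\{Q\}$).
   Context: $\mathrm{mod}\text{-}R$ is the category of finitely presented $R$-modules, $\mathrm{Spec}(R)$ the set of prime ideals of $R$, and $E(-)$ denotes injective hull. A Serre subcategory of an abelian category $\mathcal{A}$ is a full subcategory containing $0$ and closed under subobjects, quotient objects and extensions. For a skeletally small abelian category $\mathcal{A}$, $\mathrm{Ser}(\mathcal{A})$ is the lattice of Serre subcategories of $\mathcal{A}$ ordered by inclusion; the meet is intersection and the join is the Serre subcategory generated by the union. $\mathrm{Sp}(\mathcal{A})$ is the set of prime elements of this lattice: those $\mathcal{S}\in\mathrm{Ser}(\mathcal{A})$ with $\mathcal{S}\neq\mathcal{A}$ such that $\mathcal{S}\supseteq \mathcal{S}_1\cap\mathcal{S}_2$ implies $\mathcal{S}\supseteq\mathcal{S}_1$ or $\mathcal{S}\supseteq \mathcal{S}_2$ for all $\mathcal{S}_1,\mathcal{S}_2\in\mathrm{Ser}(\mathcal{A})$ (equivalently,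 $\mathcal{S}\neq\mathcal{A}$ and $\mathcal{S}=\mathcal{S}_1\cap\mathcal{S}_2$ implies $\mathcal{S}=\mathcal{S}_1$ or $\mathcal{S}=\mathcal{S}_2$). *)

theory Defs
  imports "HOL-Analysis.Abstract_Topology" "HOL-Algebra.Module" "HOL-Algebra.Ring_Divisibility"
begin

section \<open>Modules and finite presentation\<close>

text \<open>
  In a module record only the additive and scalar structure is meaningful; the inherited ring
  fields (multiplication and one) are ignored by everything below.
\<close>

definition Hom ::
  "('a, 'r) ring_scheme \<Rightarrow> ('a, 'b) module \<Rightarrow> ('a, 'c) module \<Rightarrow> ('b \<Rightarrow> 'c) set"
  where "Hom R M N = {h \<in> carrier M \<rightarrow>\<^sub>E carrier N.
     (\<forall>x\<in>carrier M. \<forall>y\<in>carrier M. h (x \<oplus>\<^bsub>M\<^esub> y) = h x \<oplus>\<^bsub>N\<^esub> h y) \<and>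
     (\<forall>r\<in>carrier R. \<forall>x\<in>carrier M. h (r \<odot>\<^bsub>M\<^esub> x) = r \<odot>\<^bsub>N\<^esub> h x)}"

definition zero_map :: "('a, 'b) module \<Rightarrow> ('a, 'c) module \<Rightarrow> 'b \<Rightarrow> 'c"
  where "zero_map M N = (\<lambda>x\<in>carrier M. \<zero>\<^bsub>N\<^esub>)"

definition module_ker :: "('a, 'b) module \<Rightarrow> ('a, 'c) module \<Rightarrow> ('b \<Rightarrow> 'c) \<Rightarrow> 'b set"
  where "module_ker M N h = {x \<in> carrier M. h x = \<zero>\<^bsub>N\<^esub>}"

definition free_module :: "('a, 'r) ring_scheme \<Rightarrow> nat \<Rightarrow> ('a, nat \<Rightarrow> 'a) module"
  where "free_module R n =
    \<lparr>carrier = {..<n} \<rightarrow>\<^sub>E carrier R,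
     monoid.mult = (\<lambda>x y. \<lambda>i\<in>{..<n}. x i \<otimes>\<^bsub>R\<^esub> y i),
     one = (\<lambda>i\<in>{..<n}. \<one>\<^bsub>R\<^esub>),
     ring.zero = (\<lambda>i\<in>{..<n}. \<zero>\<^bsub>R\<^esub>),
     add = (\<lambda>x y. \<lambda>i\<in>{..<n}. x i \<oplus>\<^bsub>R\<^esub> y i),
     smult = (\<lambda>r x. \<lambda>i\<in>{..<n}. r \<otimes>\<^bsub>R\<^esub> x i)\<rparr>"

text \<open>Exactness of \<open>R\<^sup>m \<rightarrow> R\<^sup>n \<rightarrow> M \<rightarrow> 0\<close>.\<close>

definition finitely_presented :: "('a, 'r) ring_scheme \<Rightarrow> ('a, 'b) module \<Rightarrow> bool"
  where "finitely_presented R M \<longleftrightarrow> Module.module R M \<and>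
    (\<exists>m n. \<exists>f \<in> Hom R (free_module R m) (free_module R n). \<exists>g \<in> Hom R (free_module R n) M.
       g ` carrier (free_module R n) = carrier M \<and>
       module_ker (free_module R n) M g = f ` carrier (free_module R m))"

text \<open>
  A type holding the underlying sets of small modules. Every finitely presented module is
  isomorphic to some \<open>R\<^sup>n/K\<close>, whose elements are cosets, i.e. sets of functions from \<open>nat\<close> to \<open>'a\<close>.
  Hence the finitely presented modules with elements in this type form a full subcategory
  equivalent to the category of all finitely presented modules.
\<close>

type_synonym 'a elem = "(nat \<Rightarrow> 'a) set"

definition mod_fp :: "('a, 'r) ring_scheme \<Rightarrow> ('a, 'a elem) module set"
  where "mod_fp R = {M. finitely_presented R M}"


section \<open>Serre subcategories\<close>

text \<open>
  A full subcategory is given by its class of objects. It is automatically closed under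
  isomorphism, by closure under subobjects. Over a noetherian ring, the monomorphisms
  (epimorphisms) of the category of finitely presented modules are the injective (surjective)
  homomorphisms.
\<close>

definition short_exact ::
  "('a, 'r) ring_scheme \<Rightarrow> ('a, 'b) module \<Rightarrow> ('b \<Rightarrow> 'c) \<Rightarrow> ('a, 'c) module \<Rightarrow> ('c \<Rightarrow> 'd)
     \<Rightarrow> ('a, 'd) module \<Rightarrow> bool"
  where "short_exact R A f B g C \<longleftrightarrow>
    f \<in> Hom R A B \<and> g \<in> Hom R B C \<and> inj_on f (carrier A) \<and>
    f ` carrier A = module_ker B C g \<and> g ` carrier B = carrier C"

definition serre_subcategory ::
  "('a, 'r) ring_scheme \<Rightarrow> ('a, 'a elem) module set \<Rightarrow> bool"
  where "serre_subcategory R S \<longleftrightarrow> S \<subseteq> mod_fp R \<and>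
    (\<forall>Z \<in> mod_fp R. carrier Z = {\<zero>\<^bsub>Z\<^esub>} \<longrightarrow> Z \<in> S) \<and>
    (\<forall>A \<in> mod_fp R. \<forall>B \<in> S. \<forall>f \<in> Hom R A B. inj_on f (carrier A) \<longrightarrow> A \<in> S) \<and>
    (\<forall>B \<in> S. \<forall>C \<in> mod_fp R. \<forall>g \<in> Hom R B C. g ` carrier B = carrier C \<longrightarrow> C \<in> S) \<and>
    (\<forall>A \<in> S. \<forall>B \<in> mod_fp R. \<forall>C \<in> S. \<forall>f g. short_exact R A f B g C \<longrightarrow> B \<in> S)"

definition Ser :: "('a, 'r) ring_scheme \<Rightarrow> ('a, 'a elem) module set set"
  where "Ser R = {S. serre_subcategory R S}"

definition Sp :: "('a, 'r) ring_scheme \<Rightarrow> ('a, 'a elem) module set set"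
  where "Sp R = {S \<in> Ser R. S \<noteq> mod_fp R \<and>
    (\<forall>S1 \<in> Ser R. \<forall>S2 \<in> Ser R. S1 \<inter> S2 \<subseteq> S \<longrightarrow> S1 \<subseteq> S \<or> S2 \<subseteq> S)}"


section \<open>Injective hulls\<close>

text \<open>
  Lifting is required along all monomorphisms between modules with elements in \<open>'a elem\<close>, since
  a definition cannot quantify over types. As this type accommodates a copy of the ring and of
  all its ideals, Baer's criterion yields lifting along monomorphisms in every type.
\<close>

definition injective_module :: "('a, 'r) ring_scheme \<Rightarrow> ('a, 'e) module \<Rightarrow> bool"
  where "injective_module R E \<longleftrightarrow> Module.module R E \<and>
    (\<forall>(A :: ('a, 'a elem) module) (B :: ('a, 'a elem) module).
       Module.module R A \<longrightarrow> Module.module R B \<longrightarrow>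
       (\<forall>i \<in> Hom R A B. \<forall>f \<in> Hom R A E. inj_on i (carrier A) \<longrightarrow>
          (\<exists>h \<in> Hom R B E. \<forall>x\<in>carrier A. h (i x) = f x)))"

definition essential_submodule :: "('a, 'r) ring_scheme \<Rightarrow> 'e set \<Rightarrow> ('a, 'e) module \<Rightarrow> bool"
  where "essential_submodule R N E \<longleftrightarrow> submodule N R E \<and>
    (\<forall>L. submodule L R E \<longrightarrow> L \<inter> N = {\<zero>\<^bsub>E\<^esub>} \<longrightarrow> L = {\<zero>\<^bsub>E\<^esub>})"

definition injective_hull ::
  "('a, 'r) ring_scheme \<Rightarrow> ('a, 'b) module \<Rightarrow> ('a, 'e) module \<Rightarrow> bool"
  where "injective_hull R M E \<longleftrightarrow> injective_module R E \<and>
    (\<exists>\<iota> \<in> Hom R M E. inj_on \<iota> (carrier M) \<and> essential_submodule R (\<iota> ` carrier M) E)"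

text \<open>The library's quotient ring \<open>R Quot I\<close>, regarded as an \<open>R\<close>-module.\<close>

definition quotient_module :: "('a, 'r) ring_scheme \<Rightarrow> 'a set \<Rightarrow> ('a, 'a set) module"
  where "quotient_module R I =
    \<lparr>carrier = carrier (R Quot I), monoid.mult = monoid.mult (R Quot I), one = one (R Quot I),
     ring.zero = ring.zero (R Quot I), add = add (R Quot I),
     smult = (\<lambda>r X. (I +>\<^bsub>R\<^esub> r) \<otimes>\<^bsub>R Quot I\<^esub> X)\<rparr>"

text \<open>For an injective hull \<open>E\<close> of \<open>R/P\<close> this is the class \<open>S\<^sub>P\<close>.\<close>

definition hom_orthogonal ::
  "('a, 'r) ring_scheme \<Rightarrow> ('a, 'e) module \<Rightarrow> ('a, 'a elem) module set"
  where "hom_orthogonal R E = {A \<in> mod_fp R. Hom R A E = {zero_map A E}}"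


section \<open>The prime spectrum\<close>

definition Spec :: "('a, 'r) ring_scheme \<Rightarrow> 'a set set"
  where "Spec R = {P. primeideal P R}"

definition zariski :: "('a, 'r) ring_scheme \<Rightarrow> 'a set topology"
  where "zariski R = topology (\<lambda>U. \<exists>X \<subseteq> carrier R. U = {P \<in> Spec R. \<not> X \<subseteq> P})"

lemma openin_zariski:
  "openin (zariski R) U \<longleftrightarrow> (\<exists>X \<subseteq> carrier R. U = {P \<in> Spec R. \<not> X \<subseteq> P})"
proof -
  let ?D = "\<lambda>X. {P \<in> Spec R. \<not> X \<subseteq> P}"
  have inter: "\<exists>Z \<subseteq> carrier R. ?D X \<inter> ?D Y = ?D Z"
    if X: "X \<subseteq> carrier R" and Y: "Y \<subseteq> carrier R" for X Y
  proof -
    let ?Z = "{a \<otimes>\<^bsub>R\<^esub> b | a b. a \<in> X \<and> b \<in> Y} \<inter> carrier R"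
    have "(\<not> X \<subseteq> P \<and> \<not> Y \<subseteq> P) \<longleftrightarrow> \<not> ?Z \<subseteq> P" if "P \<in> Spec R" for P
    proof -
      interpret primeideal P R using that by (simp add: Spec_def)
      show ?thesis
      proof
        assume "\<not> X \<subseteq> P \<and> \<not> Y \<subseteq> P"
        then obtain a b where ab: "a \<in> X" "a \<notin> P" "b \<in> Y" "b \<notin> P" by blast
        then have "a \<in> carrier R" "b \<in> carrier R" using X Y by blast+
        then have "a \<otimes>\<^bsub>R\<^esub> b \<in> ?Z" "a \<otimes>\<^bsub>R\<^esub> b \<notin> P" using ab I_prime by blast+
        then show "\<not> ?Z \<subseteq> P" by blast
      next
        assume "\<not> ?Z \<subseteq> P"
        then obtain a b where ab: "a \<in> X" "b \<in> Y" "a \<otimes>\<^bsub>R\<^esub> b \<notin> P" by blast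
        then have "a \<in> carrier R" "b \<in> carrier R" using X Y by blast+
        then have "a \<notin> P" "b \<notin> P" using ab(3) I_l_closed I_r_closed by blast+
        then show "\<not> X \<subseteq> P \<and> \<not> Y \<subseteq> P" using ab by blast
      qed
    qed
    then have "?D X \<inter> ?D Y = ?D ?Z" by blast
    moreover have "?Z \<subseteq> carrier R" by blast
    ultimately show ?thesis by blast
  qed
  have union: "\<exists>Z \<subseteq> carrier R. \<Union>\<K> = ?D Z"
    if opens: "\<forall>K\<in>\<K>. \<exists>X \<subseteq> carrier R. K = ?D X" for \<K>
  proof -
    obtain F where F: "\<forall>K\<in>\<K>. F K \<subseteq> carrier R \<and> K = ?D (F K)"
      using bchoice[OF opens] by blast
    have "(\<Union>K\<in>\<K>. ?D (F K)) = (\<Union>K\<in>\<K>. K)" by (rule SUP_cong) (use F in blast)+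
    then have "\<Union>\<K> = (\<Union>K\<in>\<K>. ?D (F K))" by simp
    also have "\<dots> = ?D (\<Union>K\<in>\<K>. F K)" by blast
    finally have "\<Union>\<K> = ?D (\<Union>K\<in>\<K>. F K)" .
    moreover have "(\<Union>K\<in>\<K>. F K) \<subseteq> carrier R" using F by blast
    ultimately show ?thesis by blast
  qed
  have "istopology (\<lambda>U. \<exists>X \<subseteq> carrier R. U = ?D X)"
    unfolding istopology_def
  proof (intro conjI allI impI)
    fix S T assume "\<exists>X \<subseteq> carrier R. S = ?D X" "\<exists>X \<subseteq> carrier R. T = ?D X"
    then obtain X Y where "X \<subseteq> carrier R" "S = ?D X" "Y \<subseteq> carrier R" "T = ?D Y" by (elim exE conjE)
    then show "\<exists>X \<subseteq> carrier R. S \<inter> T = ?D X" using inter[of X Y] by simp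
  next
    fix \<K> assume "\<forall>K\<in>\<K>. \<exists>X \<subseteq> carrier R. K = ?D X"
    then show "\<exists>X \<subseteq> carrier R. \<Union>\<K> = ?D X" by (rule union)
  qed
  then show ?thesis by (simp add: zariski_def)
qed

end

theory Submission
  imports Defs
begin

text \<open>
  Write \<open>supp A\<close> for the set of primes \<open>P\<close> such that some \<open>x \<in> A\<close> has \<open>ann x \<subseteq> P\<close>, that is, such that
  the localisation of \<open>A\<close> at \<open>P\<close> is nonzero. The argument replaces homomorphisms into \<open>E(R/P)\<close> by
  supports.

  First, \<open>Hom(A, E(R/P)) = 0\<close> iff \<open>P \<notin> supp A\<close> (\<open>hom_orthogonal_injective_hull\<close>). If
  \<open>ann x \<subseteq> P\<close>, then \<open>Rx \<cong> R/ann x \<rightarrow> R/P \<rightarrow> E(R/P)\<close> is nonzero and extends to \<open>A\<close> by injectivity.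
  Conversely, if \<open>h(x) \<noteq> 0\<close>, then by essentiality some \<open>r h(x)\<close> is a nonzero element of \<open>R/P\<close>, whose
  annihilator is \<open>P\<close>, so \<open>ann(rx) \<subseteq> P\<close>.

  Second, a Serre subcategory \<open>S\<close> is determined by the primes \<open>Q\<close> with \<open>R/Q \<in> S\<close>: a finitely presented
  \<open>A\<close> lies in \<open>S\<close> iff \<open>R/Q \<in> S\<close> for all \<open>Q \<in> supp A\<close> (\<open>serre_iff_primes_of_supp\<close>). Dividing out one
  generator after another reduces this to cyclic modules \<open>R/I\<close>, and an ideal \<open>I\<close> that is maximal among
  those with \<open>R/I \<notin> S\<close> is prime: for \<open>ab \<in> I\<close> with \<open>a, b \<notin> I\<close> the sequence
  \<open>0 \<rightarrow> R/(I : a) \<rightarrow> R/I \<rightarrow> R/(I + Ra) \<rightarrow> 0\<close> would put \<open>R/I\<close> into \<open>S\<close>.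

  Now let \<open>S\<close> be a prime element of the lattice and \<open>T = {Q. R/Q \<notin> S}\<close>. For \<open>P, Q \<in> T\<close> the Serre
  subcategories of modules supported on \<open>V(P)\<close> and on \<open>V(Q)\<close> are not contained in \<open>S\<close>, hence neither
  is their intersection, and so some prime containing \<open>P\<close> and \<open>Q\<close> lies in \<open>T\<close>
  (\<open>Sp_primes_directed\<close>). By the ascending chain condition \<open>T\<close> has a greatest element \<open>M\<close>, and since
  supports are closed under passing to larger primes, \<open>S\<close> consists of the modules whose support does
  not contain \<open>M\<close>. In the other direction these classes are prime, because a Serre subcategory not
  contained in the one of \<open>P\<close> contains \<open>R/P\<close>.
\<close>

section \<open>Homomorphisms and submodules\<close>

lemma HomI:
  assumes "\<And>x. x \<in> carrier M \<Longrightarrow> h x \<in> carrier N"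
    and "\<And>x y. \<lbrakk>x \<in> carrier M; y \<in> carrier M; x \<oplus>\<^bsub>M\<^esub> y \<in> carrier M\<rbrakk>
           \<Longrightarrow> h (x \<oplus>\<^bsub>M\<^esub> y) = h x \<oplus>\<^bsub>N\<^esub> h y"
    and "\<And>r x. \<lbrakk>r \<in> carrier R; x \<in> carrier M; r \<odot>\<^bsub>M\<^esub> x \<in> carrier M\<rbrakk>
           \<Longrightarrow> h (r \<odot>\<^bsub>M\<^esub> x) = r \<odot>\<^bsub>N\<^esub> h x"
    and "module R M"
  shows "restrict h (carrier M) \<in> Hom R M N"
proof -
  interpret module R M by fact
  show ?thesis using assms by (simp add: Hom_def)
qed

lemma Hom_closed: "\<lbrakk>h \<in> Hom R M N; x \<in> carrier M\<rbrakk> \<Longrightarrow> h x \<in> carrier N"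
  and Hom_add: "\<lbrakk>h \<in> Hom R M N; x \<in> carrier M; y \<in> carrier M\<rbrakk> \<Longrightarrow> h (x \<oplus>\<^bsub>M\<^esub> y) = h x \<oplus>\<^bsub>N\<^esub> h y"
  and Hom_smult: "\<lbrakk>h \<in> Hom R M N; r \<in> carrier R; x \<in> carrier M\<rbrakk> \<Longrightarrow> h (r \<odot>\<^bsub>M\<^esub> x) = r \<odot>\<^bsub>N\<^esub> h x"
  and Hom_extensional: "h \<in> Hom R M N \<Longrightarrow> h \<in> extensional (carrier M)"
  by (auto simp: Hom_def PiE_def)

lemma Hom_image_subset: "h \<in> Hom R M N \<Longrightarrow> h ` carrier M \<subseteq> carrier N"
  by (auto dest: Hom_closed)

lemma mem_module_ker: "x \<in> module_ker M N h \<longleftrightarrow> x \<in> carrier M \<and> h x = \<zero>\<^bsub>N\<^esub>"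
  by (simp add: module_ker_def)

context cring
begin

lemma Hom_zero:
  assumes "module R M" "module R N" "h \<in> Hom R M N"
  shows "h \<zero>\<^bsub>M\<^esub> = \<zero>\<^bsub>N\<^esub>"
proof -
  interpret M: module R M by fact
  interpret N: module R N by fact
  have "h (\<zero> \<odot>\<^bsub>M\<^esub> \<zero>\<^bsub>M\<^esub>) = \<zero> \<odot>\<^bsub>N\<^esub> h \<zero>\<^bsub>M\<^esub>"
    using Hom_smult[OF assms(3)] by blast
  then show ?thesis using Hom_closed[OF assms(3)] by simp
qed

lemma Hom_minus:
  assumes "module R M" "module R N" "h \<in> Hom R M N" "x \<in> carrier M" "y \<in> carrier M"
  shows "h (x \<ominus>\<^bsub>M\<^esub> y) = h x \<ominus>\<^bsub>N\<^esub> h y"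
proof -
  interpret M: module R M by fact
  interpret N: module R N by fact
  have "h (\<ominus>\<^bsub>M\<^esub> y) = h ((\<ominus> \<one>) \<odot>\<^bsub>M\<^esub> y)"
    using assms by (simp add: M.smult_l_minus)
  also have "\<dots> = (\<ominus> \<one>) \<odot>\<^bsub>N\<^esub> h y"
    using assms by (intro Hom_smult) auto
  also have "\<dots> = \<ominus>\<^bsub>N\<^esub> h y"
    using assms by (simp add: N.smult_l_minus Hom_closed)
  finally have "h (\<ominus>\<^bsub>M\<^esub> y) = \<ominus>\<^bsub>N\<^esub> h y" .
  then show ?thesis
    using assms by (simp add: a_minus_def Hom_add)
qed

lemma minus_eq_zero_iff:
  assumes "module R M" "x \<in> carrier M" "y \<in> carrier M"
  shows "x \<ominus>\<^bsub>M\<^esub> y = \<zero>\<^bsub>M\<^esub> \<longleftrightarrow> x = y"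
proof -
  interpret M: module R M by fact
  show ?thesis
    using M.add.inv_solve_right[of "\<zero>\<^bsub>M\<^esub>" x y] assms(2,3) by (auto simp: a_minus_def)
qed

lemma Hom_eq_iff_minus_in_ker:
  assumes "module R M" "module R N" "h \<in> Hom R M N" "x \<in> carrier M" "y \<in> carrier M"
  shows "h x = h y \<longleftrightarrow> x \<ominus>\<^bsub>M\<^esub> y \<in> module_ker M N h"
proof -
  interpret M: module R M by fact
  show ?thesis
    using assms by (simp add: mem_module_ker Hom_minus minus_eq_zero_iff Hom_closed)
qed

lemma Hom_inj_iff:
  assumes "module R M" "module R N" "h \<in> Hom R M N"
  shows "inj_on h (carrier M) \<longleftrightarrow> module_ker M N h \<subseteq> {\<zero>\<^bsub>M\<^esub>}"
proof
  assume "inj_on h (carrier M)"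
  then show "module_ker M N h \<subseteq> {\<zero>\<^bsub>M\<^esub>}"
    using assms Hom_zero[OF assms]
    by (auto simp: mem_module_ker inj_on_def)
       (metis abelian_groupE(2) module.axioms(2))
next
  assume "module_ker M N h \<subseteq> {\<zero>\<^bsub>M\<^esub>}"
  then show "inj_on h (carrier M)"
    using Hom_eq_iff_minus_in_ker[OF assms] minus_eq_zero_iff[OF assms(1)]
    by (intro inj_onI) blast
qed

text \<open>
  If \<open>g\<close> is onto and kills no more than \<open>h\<close> does, then \<open>h\<close> factors through \<open>g\<close>.
\<close>

lemma Hom_factor:
  assumes M: "module R M" and N: "module R N" and L: "module R L"
    and g: "g \<in> Hom R M N" and surj: "g ` carrier M = carrier N"
    and h: "h \<in> Hom R M L" and ker: "module_ker M N g \<subseteq> module_ker M L h"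
  obtains k where "k \<in> Hom R N L" "\<forall>x\<in>carrier M. k (g x) = h x"
proof -
  interpret M: module R M by fact
  define k where "k = restrict (\<lambda>y. h (inv_into (carrier M) g y)) (carrier N)"
  have kg: "k (g x) = h x" if x: "x \<in> carrier M" for x
  proof -
    let ?y = "inv_into (carrier M) g (g x)"
    have y: "?y \<in> carrier M" "g ?y = g x"
      using x by (auto intro: inv_into_into f_inv_into_f)
    then have "h ?y = h x"
      using ker x Hom_eq_iff_minus_in_ker[OF M N g] Hom_eq_iff_minus_in_ker[OF M L h] by blast
    then show ?thesis using x g by (simp add: k_def Hom_closed)
  qed
  have "restrict k (carrier N) \<in> Hom R N L"
  proof (rule HomI)
    fix x y assume "x \<in> carrier N" "y \<in> carrier N"
    then obtain x' y' where x': "x' \<in> carrier M" "x = g x'" and y': "y' \<in> carrier M" "y = g y'"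
      using surj by blast
    then have "x \<oplus>\<^bsub>N\<^esub> y = g (x' \<oplus>\<^bsub>M\<^esub> y')" using Hom_add[OF g] by simp
    then show "k (x \<oplus>\<^bsub>N\<^esub> y) = k x \<oplus>\<^bsub>L\<^esub> k y"
      using x' y' kg Hom_add[OF h] by simp
  next
    fix r x assume r: "r \<in> carrier R" and "x \<in> carrier N"
    then obtain x' where x': "x' \<in> carrier M" "x = g x'"
      using surj by blast
    then have "r \<odot>\<^bsub>N\<^esub> x = g (r \<odot>\<^bsub>M\<^esub> x')" using Hom_smult[OF g r] by simp
    then show "k (r \<odot>\<^bsub>N\<^esub> x) = r \<odot>\<^bsub>L\<^esub> k x"
      using x' r kg Hom_smult[OF h] by simp
  next
    fix x assume "x \<in> carrier N"
    then obtain x' where x': "x' \<in> carrier M" "x = g x'" using surj by blast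
    then show "k x \<in> carrier L" using kg Hom_closed[OF h] by simp
  qed (rule N)
  moreover have "restrict k (carrier N) (g x) = h x" if "x \<in> carrier M" for x
    using that kg g by (simp add: Hom_closed)
  ultimately show thesis using that by blast
qed

lemma submodule_iff:
  assumes "module R M"
  shows "submodule H R M \<longleftrightarrow> H \<subseteq> carrier M \<and> \<zero>\<^bsub>M\<^esub> \<in> H \<and>
    (\<forall>x\<in>H. \<forall>y\<in>H. x \<oplus>\<^bsub>M\<^esub> y \<in> H) \<and> (\<forall>r\<in>carrier R. \<forall>x\<in>H. r \<odot>\<^bsub>M\<^esub> x \<in> H)"
proof -
  interpret M: module R M by fact
  show ?thesis
  proof
    assume H: "submodule H R M"
    then have "\<zero>\<^bsub>M\<^esub> \<in> H"
      using subgroup.one_closed[OF submodule.axioms(1)[OF H]] by simp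
    then show "H \<subseteq> carrier M \<and> \<zero>\<^bsub>M\<^esub> \<in> H \<and>
      (\<forall>x\<in>H. \<forall>y\<in>H. x \<oplus>\<^bsub>M\<^esub> y \<in> H) \<and> (\<forall>r\<in>carrier R. \<forall>x\<in>H. r \<odot>\<^bsub>M\<^esub> x \<in> H)"
      using M.submoduleE[OF H] by blast
  next
    assume H: "H \<subseteq> carrier M \<and> \<zero>\<^bsub>M\<^esub> \<in> H \<and>
      (\<forall>x\<in>H. \<forall>y\<in>H. x \<oplus>\<^bsub>M\<^esub> y \<in> H) \<and> (\<forall>r\<in>carrier R. \<forall>x\<in>H. r \<odot>\<^bsub>M\<^esub> x \<in> H)"
    show "submodule H R M"
    proof (rule M.submoduleI)
      fix a assume a: "a \<in> H"
      then have "\<ominus>\<^bsub>M\<^esub> a = (\<ominus> \<one>) \<odot>\<^bsub>M\<^esub> a"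
        using H by (subst M.smult_l_minus) auto
      also have "\<dots> \<in> H" using H a by blast
      finally show "\<ominus>\<^bsub>M\<^esub> a \<in> H" .
    qed (use H in auto)
  qed
qed

lemma submodule_minus:
  assumes "module R M" "submodule H R M" "x \<in> H" "y \<in> H"
  shows "x \<ominus>\<^bsub>M\<^esub> y \<in> H"
proof -
  interpret M: module R M by fact
  show ?thesis
    using assms(2-4) M.submoduleE(3,5)[OF assms(2)] by (simp add: a_minus_def)
qed

lemma submodule_image:
  assumes "module R M" "module R N" "h \<in> Hom R M N" "submodule K R M"
  shows "submodule (h ` K) R N"
proof -
  have K: "K \<subseteq> carrier M" "\<zero>\<^bsub>M\<^esub> \<in> K" "\<And>x y. \<lbrakk>x \<in> K; y \<in> K\<rbrakk> \<Longrightarrow> x \<oplus>\<^bsub>M\<^esub> y \<in> K"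
      "\<And>r x. \<lbrakk>r \<in> carrier R; x \<in> K\<rbrakk> \<Longrightarrow> r \<odot>\<^bsub>M\<^esub> x \<in> K"
    using assms(4) by (auto simp: submodule_iff[OF assms(1)])
  have "h x \<oplus>\<^bsub>N\<^esub> h y \<in> h ` K" if "x \<in> K" "y \<in> K" for x y
    using K that Hom_add[OF assms(3)] by (metis imageI subsetD)
  moreover have "r \<odot>\<^bsub>N\<^esub> h x \<in> h ` K" if "r \<in> carrier R" "x \<in> K" for r x
    using K that Hom_smult[OF assms(3)] by (metis imageI subsetD)
  moreover have "\<zero>\<^bsub>N\<^esub> \<in> h ` K" using K Hom_zero[OF assms(1-3)] by (metis imageI)
  ultimately show ?thesis
    using K(1) Hom_image_subset[OF assms(3)] unfolding submodule_iff[OF assms(2)] by blast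
qed

lemma submodule_preimage:
  assumes "module R M" "module R N" "h \<in> Hom R M N" "submodule K R N"
  shows "submodule {x \<in> carrier M. h x \<in> K} R M"
proof -
  interpret M: module R M by fact
  show ?thesis
    using assms(4) Hom_zero[OF assms(1-3)] Hom_add[OF assms(3)] Hom_smult[OF assms(3)]
    by (auto simp: submodule_iff[OF assms(1)] submodule_iff[OF assms(2)])
qed

lemma submodule_zero: "module R M \<Longrightarrow> submodule {\<zero>\<^bsub>M\<^esub>} R M"
proof -
  assume M: "module R M"
  then interpret M: module R M .
  show ?thesis by (simp add: submodule_iff[OF M])
qed

lemma submodule_carrier: "module R M \<Longrightarrow> submodule (carrier M) R M"
  by (rule module.carrier_is_submodule)

lemma submodule_ker:
  assumes "module R M" "module R N" "h \<in> Hom R M N"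
  shows "submodule (module_ker M N h) R M"
proof -
  have "module_ker M N h = {x \<in> carrier M. h x \<in> {\<zero>\<^bsub>N\<^esub>}}"
    by (auto simp: module_ker_def)
  then show ?thesis
    using submodule_preimage[OF assms submodule_zero[OF assms(2)]] by simp
qed

end

section \<open>The ring as a module, free modules and quotients\<close>

text \<open>The ring \<open>R\<close> as a module over itself.\<close>

definition regular_module :: "('a, 'r) ring_scheme \<Rightarrow> ('a, 'a) module"
  where "regular_module R =
    \<lparr>carrier = carrier R, monoid.mult = monoid.mult R, one = one R, ring.zero = ring.zero R,
     add = add R, smult = monoid.mult R\<rparr>"

lemma regular_module_simps [simp]:
  "carrier (regular_module R) = carrier R"
  "\<zero>\<^bsub>regular_module R\<^esub> = \<zero>\<^bsub>R\<^esub>"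
  "add (regular_module R) = add R"
  "smult (regular_module R) = monoid.mult R"
  by (simp_all add: regular_module_def)

lemma free_module_simps [simp]:
  "carrier (free_module R n) = {..<n} \<rightarrow>\<^sub>E carrier R"
  "\<zero>\<^bsub>free_module R n\<^esub> = (\<lambda>i\<in>{..<n}. \<zero>\<^bsub>R\<^esub>)"
  "x \<oplus>\<^bsub>free_module R n\<^esub> y = (\<lambda>i\<in>{..<n}. x i \<oplus>\<^bsub>R\<^esub> y i)"
  "r \<odot>\<^bsub>free_module R n\<^esub> x = (\<lambda>i\<in>{..<n}. r \<otimes>\<^bsub>R\<^esub> x i)"
  by (simp_all add: free_module_def)

text \<open>
  A model of \<open>M/N\<close>, with \<open>quot_map\<close> as projection: every coset is represented by one of its elements,
  and the representatives are carried into another type by an injection \<open>\<epsilon>\<close>. Representatives instead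
  of cosets make \<open>M/N\<close> a module over the same type as \<open>M\<close> when \<open>\<epsilon> = id\<close>, so that quotients of
  modules with elements in \<open>'a elem\<close> stay in that type. The ring fields of the record are irrelevant.
\<close>

definition quot_map :: "('b \<Rightarrow> 'c) \<Rightarrow> ('a, 'b) module \<Rightarrow> 'b set \<Rightarrow> 'b \<Rightarrow> 'c"
  where "quot_map \<epsilon> M N = (\<lambda>x\<in>carrier M. \<epsilon> (SOME y. y \<in> carrier M \<and> y \<ominus>\<^bsub>M\<^esub> x \<in> N))"

definition quot :: "('b \<Rightarrow> 'c) \<Rightarrow> ('a, 'b) module \<Rightarrow> 'b set \<Rightarrow> ('a, 'c) module"
  where "quot \<epsilon> M N = (let q = quot_map \<epsilon> M N; s = inv_into (carrier M) q in
    \<lparr>carrier = q ` carrier M, monoid.mult = undefined, one = undefined, ring.zero = q \<zero>\<^bsub>M\<^esub>,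
     add = (\<lambda>u v. q (s u \<oplus>\<^bsub>M\<^esub> s v)), smult = (\<lambda>r u. q (r \<odot>\<^bsub>M\<^esub> s u))\<rparr>)"

context cring
begin

lemma module_regular: "module R (regular_module R)"
proof (rule moduleI)
  show "abelian_group (regular_module R)"
  proof (rule abelian_groupI)
    fix x assume "x \<in> carrier (regular_module R)"
    then show "\<exists>y\<in>carrier (regular_module R). y \<oplus>\<^bsub>regular_module R\<^esub> x = \<zero>\<^bsub>regular_module R\<^esub>"
      by (auto intro!: bexI[of _ "\<ominus> x"] simp: l_neg)
  qed (auto simp: a_ac)
qed (auto simp: cring_axioms l_distr r_distr m_assoc)

lemma module_free: "module R (free_module R n)"
proof (rule moduleI)
  show "abelian_group (free_module R n)"
  proof (rule abelian_groupI)
    fix x assume x: "x \<in> carrier (free_module R n)"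
    let ?y = "\<lambda>i\<in>{..<n}. \<ominus> x i"
    have "?y \<in> carrier (free_module R n)" using x by auto
    moreover have "?y \<oplus>\<^bsub>free_module R n\<^esub> x = \<zero>\<^bsub>free_module R n\<^esub>"
      using x by (auto simp: PiE_iff l_neg intro!: restrict_ext)
    ultimately show "\<exists>y\<in>carrier (free_module R n). y \<oplus>\<^bsub>free_module R n\<^esub> x = \<zero>\<^bsub>free_module R n\<^esub>"
      by blast
  qed (auto simp: PiE_iff extensional_def a_ac fun_eq_iff)
qed (auto simp: PiE_iff extensional_def cring_axioms l_distr r_distr m_assoc fun_eq_iff)

lemma submodule_regular_iff_ideal: "submodule I R (regular_module R) \<longleftrightarrow> ideal I R"
proof
  assume "submodule I R (regular_module R)"
  then have I: "I \<subseteq> carrier R" "\<zero> \<in> I" "\<And>x y. \<lbrakk>x \<in> I; y \<in> I\<rbrakk> \<Longrightarrow> x \<oplus> y \<in> I"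
      "\<And>r x. \<lbrakk>r \<in> carrier R; x \<in> I\<rbrakk> \<Longrightarrow> r \<otimes> x \<in> I"
    by (auto simp: submodule_iff[OF module_regular])
  show "ideal I R"
  proof (rule idealI)
    show "subgroup I (add_monoid R)"
    proof (rule add.subgroupI)
      fix a assume a: "a \<in> I"
      then have "a \<in> carrier R" using I(1) by blast
      then have "\<ominus> a = (\<ominus> \<one>) \<otimes> a" by (simp add: l_minus)
      then show "\<ominus> a \<in> I" using I(4) a by simp
    qed (use I in auto)
    fix a x assume "a \<in> I" "x \<in> carrier R"
    then show "x \<otimes> a \<in> I" "a \<otimes> x \<in> I"
      using I(1,4) m_comm[of a x] by auto
  qed (rule ring_axioms)
next
  assume "ideal I R"
  then interpret ideal I R .
  show "submodule I R (regular_module R)"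
    by (auto simp: submodule_iff[OF module_regular] I_l_closed)
qed

text \<open>The homomorphism \<open>R \<rightarrow> M\<close> with value \<open>x\<close> at one.\<close>

lemma Hom_regular:
  assumes "module R M" "x \<in> carrier M"
  shows "(\<lambda>r\<in>carrier R. r \<odot>\<^bsub>M\<^esub> x) \<in> Hom R (regular_module R) M"
proof -
  interpret M: module R M by fact
  show ?thesis
    using HomI[of "regular_module R" "\<lambda>r. r \<odot>\<^bsub>M\<^esub> x" M R] module_regular assms
    by (auto simp: M.smult_l_distr M.smult_assoc1)
qed

lemma Hom_cyclic_submodule:
  fixes M :: "('a, 'm) module"
  assumes "module R M" "x \<in> carrier M"
  shows "submodule ((\<lambda>r. r \<odot>\<^bsub>M\<^esub> x) ` carrier R) R M"
  using submodule_image[OF module_regular assms(1) Hom_regular[OF assms] 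
      submodule_carrier[OF module_regular]]
  by simp

lemma quot_map_eq_iff:
  assumes M: "module R M" and N: "submodule N R M" and \<epsilon>: "inj \<epsilon>"
    and x: "x \<in> carrier M" and y: "y \<in> carrier M"
  shows "quot_map \<epsilon> M N x = quot_map \<epsilon> M N y \<longleftrightarrow> x \<ominus>\<^bsub>M\<^esub> y \<in> N"
proof -
  interpret M: module R M by fact
  interpret N: submodule N R M by fact
  let ?C = "\<lambda>x y. y \<in> carrier M \<and> y \<ominus>\<^bsub>M\<^esub> x \<in> N"
  note Nsub = M.submoduleE[OF N]
  have self: "?C x x" if "x \<in> carrier M" for x
    using that N submodule_iff[OF M] by (simp add: M.r_neg a_minus_def)
  have step: "?C y z" if "?C x z" "x \<ominus>\<^bsub>M\<^esub> y \<in> N" "x \<in> carrier M" "y \<in> carrier M" for x y z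
  proof -
    have "z \<ominus>\<^bsub>M\<^esub> y = (z \<ominus>\<^bsub>M\<^esub> x) \<oplus>\<^bsub>M\<^esub> (x \<ominus>\<^bsub>M\<^esub> y)"
      using that by (simp add: a_minus_def M.a_assoc M.r_neg1)
    then show ?thesis using that Nsub(5) by simp
  qed
  have flip: "b \<ominus>\<^bsub>M\<^esub> a \<in> N" if "a \<ominus>\<^bsub>M\<^esub> b \<in> N" "a \<in> carrier M" "b \<in> carrier M" for a b
  proof -
    have "b \<ominus>\<^bsub>M\<^esub> a = \<ominus>\<^bsub>M\<^esub> (a \<ominus>\<^bsub>M\<^esub> b)"
      using that by (simp add: a_minus_def M.minus_add M.a_comm)
    then show ?thesis using that Nsub(3) by simp
  qed
  show ?thesis
  proof
    assume "quot_map \<epsilon> M N x = quot_map \<epsilon> M N y"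
    then have eq: "(SOME z. ?C x z) = (SOME z. ?C y z)" (is "?z = _")
      using \<epsilon> x y by (simp add: quot_map_def inj_eq)
    have zx: "?C x ?z" using someI[of "?C x", OF self[OF x]] .
    have zy: "?C y ?z" unfolding eq using someI[of "?C y", OF self[OF y]] .
    show "x \<ominus>\<^bsub>M\<^esub> y \<in> N"
      using step[where x = ?z and y = y and z = x] flip[of ?z x] zx zy x y by blast
  next
    assume xy: "x \<ominus>\<^bsub>M\<^esub> y \<in> N"
    then have "?C x = ?C y"
      using step[OF _ xy x y] step[OF _ flip[OF xy x y] y x] by (intro ext iffI)
    then show "quot_map \<epsilon> M N x = quot_map \<epsilon> M N y"
      using x y by (simp add: quot_map_def)
  qed
qed

lemma quot_properties:
  assumes M: "module R M" and N: "submodule N R M" and \<epsilon>: "inj \<epsilon>"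
  shows module_quot: "module R (quot \<epsilon> M N)"
    and quot_map_Hom: "quot_map \<epsilon> M N \<in> Hom R M (quot \<epsilon> M N)"
    and quot_map_surj: "quot_map \<epsilon> M N ` carrier M = carrier (quot \<epsilon> M N)"
    and quot_map_ker: "module_ker M (quot \<epsilon> M N) (quot_map \<epsilon> M N) = N"
proof -
  interpret M: module R M by fact
  define q where "q = quot_map \<epsilon> M N"
  define Q where "Q = quot \<epsilon> M N"
  note Nsub = M.submoduleE[OF N]
  have q_eq: "q x = q y \<longleftrightarrow> x \<ominus>\<^bsub>M\<^esub> y \<in> N" if "x \<in> carrier M" "y \<in> carrier M" for x y
    using quot_map_eq_iff[OF M N \<epsilon> that] by (simp add: q_def)
  have carrier_Q: "carrier Q = q ` carrier M" and zero_Q: "\<zero>\<^bsub>Q\<^esub> = q \<zero>\<^bsub>M\<^esub>"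
    by (simp_all add: Q_def quot_def q_def Let_def)
  have s: "inv_into (carrier M) q (q x) \<in> carrier M" "q (inv_into (carrier M) q (q x)) = q x"
    if "x \<in> carrier M" for x
    using that by (auto intro: inv_into_into f_inv_into_f)
  have q_add: "q x \<oplus>\<^bsub>Q\<^esub> q y = q (x \<oplus>\<^bsub>M\<^esub> y)" if x: "x \<in> carrier M" and y: "y \<in> carrier M" for x y
  proof -
    let ?x = "inv_into (carrier M) q (q x)" and ?y = "inv_into (carrier M) q (q y)"
    have "?x \<ominus>\<^bsub>M\<^esub> x \<in> N" "?y \<ominus>\<^bsub>M\<^esub> y \<in> N"
      using s[OF x] s[OF y] q_eq x y by blast+
    then have "(?x \<ominus>\<^bsub>M\<^esub> x) \<oplus>\<^bsub>M\<^esub> (?y \<ominus>\<^bsub>M\<^esub> y) \<in> N" using Nsub(5) by blast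
    also have "(?x \<ominus>\<^bsub>M\<^esub> x) \<oplus>\<^bsub>M\<^esub> (?y \<ominus>\<^bsub>M\<^esub> y) = (?x \<oplus>\<^bsub>M\<^esub> ?y) \<ominus>\<^bsub>M\<^esub> (x \<oplus>\<^bsub>M\<^esub> y)"
      using s[OF x] s[OF y] x y by (simp add: a_minus_def M.minus_add M.a_ac)
    finally have "q (?x \<oplus>\<^bsub>M\<^esub> ?y) = q (x \<oplus>\<^bsub>M\<^esub> y)"
      using q_eq s[OF x] s[OF y] x y by simp
    then show ?thesis by (simp add: Q_def quot_def q_def Let_def)
  qed
  have q_smult: "r \<odot>\<^bsub>Q\<^esub> q x = q (r \<odot>\<^bsub>M\<^esub> x)" if r: "r \<in> carrier R" and x: "x \<in> carrier M" for r x
  proof -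
    let ?x = "inv_into (carrier M) q (q x)"
    have "?x \<ominus>\<^bsub>M\<^esub> x \<in> N"
      using s[OF x] q_eq x by blast
    then have "r \<odot>\<^bsub>M\<^esub> (?x \<ominus>\<^bsub>M\<^esub> x) \<in> N" using Nsub(4) r by blast
    also have "r \<odot>\<^bsub>M\<^esub> (?x \<ominus>\<^bsub>M\<^esub> x) = r \<odot>\<^bsub>M\<^esub> ?x \<ominus>\<^bsub>M\<^esub> r \<odot>\<^bsub>M\<^esub> x"
      using s[OF x] x r by (simp add: a_minus_def M.smult_r_distr M.smult_r_minus)
    finally have "q (r \<odot>\<^bsub>M\<^esub> ?x) = q (r \<odot>\<^bsub>M\<^esub> x)"
      using q_eq s[OF x] x r by simp
    then show ?thesis by (simp add: Q_def quot_def q_def Let_def)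
  qed
  have "module R Q"
  proof (rule moduleI)
    show "abelian_group Q"
    proof (rule abelian_groupI)
      fix u assume "u \<in> carrier Q"
      then obtain x where x: "x \<in> carrier M" "u = q x" by (auto simp: carrier_Q)
      then have "q (\<ominus>\<^bsub>M\<^esub> x) \<oplus>\<^bsub>Q\<^esub> u = \<zero>\<^bsub>Q\<^esub>"
        by (simp add: q_add zero_Q M.l_neg)
      then show "\<exists>v\<in>carrier Q. v \<oplus>\<^bsub>Q\<^esub> u = \<zero>\<^bsub>Q\<^esub>"
        using x by (auto simp: carrier_Q)
    qed (auto simp: carrier_Q zero_Q q_add M.a_ac)
  qed (auto simp: carrier_Q q_add q_smult cring_axioms M.smult_l_distr M.smult_r_distr
        M.smult_assoc1)
  then show "module R (quot \<epsilon> M N)" by (simp add: Q_def)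
  have "q \<in> extensional (carrier M)" by (simp add: q_def quot_map_def)
  then have "q \<in> Hom R M Q"
    by (auto simp: Hom_def PiE_def carrier_Q q_add q_smult)
  then show "quot_map \<epsilon> M N \<in> Hom R M (quot \<epsilon> M N)" by (simp add: q_def Q_def)
  show "quot_map \<epsilon> M N ` carrier M = carrier (quot \<epsilon> M N)"
    using carrier_Q by (simp add: q_def Q_def)
  have "x \<ominus>\<^bsub>M\<^esub> \<zero>\<^bsub>M\<^esub> = x" if "x \<in> carrier M" for x
    using that by (simp add: a_minus_def M.add.inv_one)
  then have "module_ker M Q q = N"
    using q_eq[OF _ M.zero_closed] Nsub(1)
    by (auto simp: mem_module_ker zero_Q subset_iff)
  then show "module_ker M (quot \<epsilon> M N) (quot_map \<epsilon> M N) = N" by (simp add: q_def Q_def)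
qed

end

section \<open>Finite generation over a noetherian ring\<close>

text \<open>The submodule of \<open>M\<close> generated by \<open>X\<close>.\<close>

definition gen_submodule :: "('a, 'r) ring_scheme \<Rightarrow> ('a, 'm) module \<Rightarrow> 'm set \<Rightarrow> 'm set"
  where "gen_submodule R M X = \<Inter>{N. submodule N R M \<and> X \<subseteq> N}"

text \<open>\<open>N\<close> is a finitely generated submodule of \<open>M\<close>.\<close>

definition fin_gen :: "('a, 'r) ring_scheme \<Rightarrow> ('a, 'm) module \<Rightarrow> 'm set \<Rightarrow> bool"
  where "fin_gen R M N \<longleftrightarrow> (\<exists>X. finite X \<and> X \<subseteq> carrier M \<and> N = gen_submodule R M X)"

context cring
begin

lemma gen_submodule_least: "\<lbrakk>submodule N R M; X \<subseteq> N\<rbrakk> \<Longrightarrow> gen_submodule R M X \<subseteq> N"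
  unfolding gen_submodule_def by blast

lemma gen_submodule_superset: "X \<subseteq> gen_submodule R M X"
  unfolding gen_submodule_def by blast

lemma submodule_gen_submodule:
  fixes M :: "('a, 'm) module"
  assumes M: "module R M" and X: "X \<subseteq> carrier M"
  shows "submodule (gen_submodule R M X) R M"
proof -
  have "gen_submodule R M X \<subseteq> carrier M"
    using gen_submodule_least[OF submodule_carrier[OF M] X] .
  then show ?thesis
    unfolding gen_submodule_def submodule_iff[OF M] by auto
qed

lemma gen_submodule_image:
  assumes M: "module R M" and N: "module R N" and h: "h \<in> Hom R M N" and X: "X \<subseteq> carrier M"
  shows "h ` gen_submodule R M X = gen_submodule R N (h ` X)"
proof
  have hX: "h ` X \<subseteq> carrier N" using X Hom_image_subset[OF h] by blast
  have "gen_submodule R M X \<subseteq> {x \<in> carrier M. h x \<in> gen_submodule R N (h ` X)}"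
    using submodule_preimage[OF M N h submodule_gen_submodule[OF N hX]]
  proof (rule gen_submodule_least)
    show "X \<subseteq> {x \<in> carrier M. h x \<in> gen_submodule R N (h ` X)}"
      using gen_submodule_superset[of "h ` X" N] X by blast
  qed
  then show "h ` gen_submodule R M X \<subseteq> gen_submodule R N (h ` X)" by blast
  show "gen_submodule R N (h ` X) \<subseteq> h ` gen_submodule R M X"
    using submodule_image[OF M N h submodule_gen_submodule[OF M X]]
      image_mono[OF gen_submodule_superset]
    by (rule gen_submodule_least)
qed

lemma fin_gen_image:
  assumes "module R M" "module R N" "h \<in> Hom R M N" "fin_gen R M K"
  shows "fin_gen R N (h ` K)"
proof -
  obtain X where X: "finite X" "X \<subseteq> carrier M" "K = gen_submodule R M X"
    using assms(4) by (auto simp: fin_gen_def)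
  then have "h ` K = gen_submodule R N (h ` X)" "h ` X \<subseteq> carrier N"
    using gen_submodule_image[OF assms(1-3) X(2)] Hom_image_subset[OF assms(3)] by blast+
  then show ?thesis unfolding fin_gen_def using X(1) by blast
qed

text \<open>
  Finite generation of a submodule can be tested on its image under a homomorphism and on its
  intersection with the kernel; this is the induction step for submodules of \<open>R\<^sup>n\<close>.
\<close>

lemma fin_gen_if_image_and_ker:
  assumes M: "module R M" and N: "module R N" and h: "h \<in> Hom R M N" and K: "submodule K R M"
    and image: "fin_gen R N (h ` K)" and ker: "fin_gen R M (K \<inter> module_ker M N h)"
  shows "fin_gen R M K"
proof -
  interpret M: module R M by fact
  have K_sub: "K \<subseteq> carrier M" using K by (simp add: submodule_iff[OF M])
  obtain Y where Y: "finite Y" "h ` K = gen_submodule R N Y"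
    using image by (auto simp: fin_gen_def)
  then have "Y \<subseteq> h ` K" using gen_submodule_superset by metis
  then obtain X where X: "X \<subseteq> K" "finite X" "Y = h ` X"
    using Y(1) finite_subset_image by metis
  obtain Z where Z: "finite Z" "K \<inter> module_ker M N h = gen_submodule R M Z"
    using ker by (auto simp: fin_gen_def)
  have "Z \<subseteq> K \<inter> module_ker M N h" unfolding Z(2) by (rule gen_submodule_superset)
  then have ZK: "Z \<subseteq> K" by blast
  let ?G = "gen_submodule R M (X \<union> Z)"
  have XZ: "X \<union> Z \<subseteq> carrier M" using X ZK K_sub by blast
  note G = submodule_gen_submodule[OF M XZ]
  have "?G = K"
  proof
    show "?G \<subseteq> K" using K X ZK by (intro gen_submodule_least) auto
    show "K \<subseteq> ?G"
    proof
      fix k assume k: "k \<in> K"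
      have X_sub: "X \<subseteq> carrier M" using XZ by blast
      have "h k \<in> h ` gen_submodule R M X"
        using k Y(2) X(3) gen_submodule_image[OF M N h X_sub] by blast
      then obtain s where s: "s \<in> gen_submodule R M X" "h k = h s" by blast
      have sK: "s \<in> K" using s(1) gen_submodule_least[OF K X(1)] by blast
      have "X \<subseteq> ?G" "Z \<subseteq> ?G" using gen_submodule_superset[of "X \<union> Z" M] by auto
      then have sub: "gen_submodule R M X \<subseteq> ?G" "gen_submodule R M Z \<subseteq> ?G"
        using gen_submodule_least[OF G] by auto
      have "k \<ominus>\<^bsub>M\<^esub> s \<in> K \<inter> module_ker M N h"
        using submodule_minus[OF M K k sK] s(2) Hom_eq_iff_minus_in_ker[OF M N h] k sK K_sub
        by blast
      then have "k \<ominus>\<^bsub>M\<^esub> s \<in> ?G" "s \<in> ?G" using Z(2) sub s(1) by auto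
      then have "(k \<ominus>\<^bsub>M\<^esub> s) \<oplus>\<^bsub>M\<^esub> s \<in> ?G" using G by (simp add: submodule_iff[OF M])
      also have "(k \<ominus>\<^bsub>M\<^esub> s) \<oplus>\<^bsub>M\<^esub> s = k"
        using k sK K_sub by (simp add: subset_iff a_minus_def M.a_assoc M.l_neg)
      finally show "k \<in> ?G" .
    qed
  qed
  then show ?thesis unfolding fin_gen_def using X(2) Z(1) XZ by blast
qed

text \<open>
  Induction on the number of generators: if \<open>g\<close> maps \<open>R\<^sup>n\<close> onto the submodule generated by \<open>X\<close>, then
  \<open>v \<mapsto> g (v\<^sub>0, \<dots>, v\<^sub>n\<^sub>-\<^sub>1) + v\<^sub>n a\<close> maps \<open>R\<^sup>n\<^sup>+\<^sup>1\<close> onto the one generated by \<open>X\<close> and \<open>a\<close>.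
\<close>

lemma free_module_onto_gen_submodule:
  fixes M :: "('a, 'm) module"
  assumes M: "module R M" and X: "finite X" "X \<subseteq> carrier M"
  shows "\<exists>n. \<exists>g \<in> Hom R (free_module R n) M. g ` carrier (free_module R n) = gen_submodule R M X"
  using X
proof (induction X rule: finite_induct)
  case empty
  interpret M: module R M by fact
  have "gen_submodule R M {} = {\<zero>\<^bsub>M\<^esub>}"
  proof
    show "gen_submodule R M {} \<subseteq> {\<zero>\<^bsub>M\<^esub>}"
      using submodule_zero[OF M] by (intro gen_submodule_least) auto
    show "{\<zero>\<^bsub>M\<^esub>} \<subseteq> gen_submodule R M {}"
      using submodule_gen_submodule[OF M, of "{}"] by (simp add: submodule_iff[OF M])
  qed
  moreover have "restrict (\<lambda>_. \<zero>\<^bsub>M\<^esub>) (carrier (free_module R 0)) \<in> Hom R (free_module R 0) M"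
    by (rule HomI) (auto simp: module_free)
  moreover have "restrict (\<lambda>_. \<zero>\<^bsub>M\<^esub>) (carrier (free_module R 0)) ` carrier (free_module R 0) = {\<zero>\<^bsub>M\<^esub>}"
    by simp
  ultimately show ?case by metis
next
  case (insert a X)
  interpret M: module R M by fact
  have a: "a \<in> carrier M" and X: "X \<subseteq> carrier M" using insert.prems by auto
  obtain n g where g: "g \<in> Hom R (free_module R n) M"
    and gX: "g ` carrier (free_module R n) = gen_submodule R M X"
    using insert.IH[OF X] by blast
  let ?F = "free_module R n" and ?F' = "free_module R (Suc n)"
  define f where "f v = g (restrict v {..<n}) \<oplus>\<^bsub>M\<^esub> v n \<odot>\<^bsub>M\<^esub> a" for v
  have restr: "restrict v {..<n} \<in> carrier ?F" if "v \<in> carrier ?F'" for v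
    using that by (simp add: PiE_iff)
  have coord: "v n \<in> carrier R" if "v \<in> carrier ?F'" for v
    using that by (simp add: PiE_iff)
  have f: "restrict f (carrier ?F') \<in> Hom R ?F' M"
  proof (rule HomI)
    fix v assume v: "v \<in> carrier ?F'"
    then show "f v \<in> carrier M"
      unfolding f_def using Hom_closed[OF g restr[OF v]] coord[OF v] a by simp
  next
    fix v w assume v: "v \<in> carrier ?F'" and w: "w \<in> carrier ?F'"
    have "restrict (v \<oplus>\<^bsub>?F'\<^esub> w) {..<n} = restrict v {..<n} \<oplus>\<^bsub>?F\<^esub> restrict w {..<n}"
      by (auto simp: fun_eq_iff)
    then have "g (restrict (v \<oplus>\<^bsub>?F'\<^esub> w) {..<n}) = g (restrict v {..<n}) \<oplus>\<^bsub>M\<^esub> g (restrict w {..<n})"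
      using Hom_add[OF g restr[OF v] restr[OF w]] by simp
    moreover have "(v \<oplus>\<^bsub>?F'\<^esub> w) n \<odot>\<^bsub>M\<^esub> a = v n \<odot>\<^bsub>M\<^esub> a \<oplus>\<^bsub>M\<^esub> w n \<odot>\<^bsub>M\<^esub> a"
      using coord[OF v] coord[OF w] a by (simp add: M.smult_l_distr)
    ultimately show "f (v \<oplus>\<^bsub>?F'\<^esub> w) = f v \<oplus>\<^bsub>M\<^esub> f w"
      unfolding f_def
      using Hom_closed[OF g restr[OF v]] Hom_closed[OF g restr[OF w]] coord[OF v] coord[OF w] a
      by (simp del: free_module_simps add: M.a_ac)
  next
    fix r v assume r: "r \<in> carrier R" and v: "v \<in> carrier ?F'"
    have "restrict (r \<odot>\<^bsub>?F'\<^esub> v) {..<n} = r \<odot>\<^bsub>?F\<^esub> restrict v {..<n}"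
      by (auto simp: fun_eq_iff)
    then have "g (restrict (r \<odot>\<^bsub>?F'\<^esub> v) {..<n}) = r \<odot>\<^bsub>M\<^esub> g (restrict v {..<n})"
      using Hom_smult[OF g r restr[OF v]] by simp
    moreover have "(r \<odot>\<^bsub>?F'\<^esub> v) n \<odot>\<^bsub>M\<^esub> a = r \<odot>\<^bsub>M\<^esub> (v n \<odot>\<^bsub>M\<^esub> a)"
      using coord[OF v] r a by (simp add: M.smult_assoc1)
    ultimately show "f (r \<odot>\<^bsub>?F'\<^esub> v) = r \<odot>\<^bsub>M\<^esub> f v"
      unfolding f_def
      using Hom_closed[OF g restr[OF v]] coord[OF v] a r
      by (simp del: free_module_simps add: M.smult_r_distr)
  qed (rule module_free)
  have "f ` carrier ?F' = gen_submodule R M (insert a X)" (is "_ = ?G")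
  proof
    have G: "submodule ?G R M" using submodule_gen_submodule[OF M] insert.prems by blast
    have aX: "a \<in> ?G" "X \<subseteq> ?G" using gen_submodule_superset[of "insert a X" M] by auto
    show "f ` carrier ?F' \<subseteq> ?G"
    proof clarify
      fix v assume v: "v \<in> carrier ?F'"
      have "g (restrict v {..<n}) \<in> gen_submodule R M X" using gX restr[OF v] by blast
      then have "g (restrict v {..<n}) \<in> ?G" using gen_submodule_least[OF G aX(2)] by blast
      then show "f v \<in> ?G"
        using G coord[OF v] aX(1) unfolding f_def by (simp add: submodule_iff[OF M])
    qed
    have sub: "submodule (restrict f (carrier ?F') ` carrier ?F') R M"
      using submodule_image[OF module_free M f submodule_carrier[OF module_free]] .
    show "?G \<subseteq> f ` carrier ?F'"
    proof (rule gen_submodule_least)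
      show "submodule (f ` carrier ?F') R M" using sub by simp
      have "a \<in> f ` carrier ?F'"
      proof
        let ?v = "(\<zero>\<^bsub>?F\<^esub>)(n := \<one>)"
        have "restrict ?v {..<n} = \<zero>\<^bsub>?F\<^esub>" by (auto simp: fun_eq_iff)
        then have "g (restrict ?v {..<n}) = \<zero>\<^bsub>M\<^esub>" using Hom_zero[OF module_free M g] by simp
        then show "a = f ?v" using a by (simp add: f_def)
        show "?v \<in> carrier ?F'" by (auto simp: PiE_iff extensional_def)
      qed
      moreover have "x \<in> f ` carrier ?F'" if "x \<in> X" for x
      proof -
        have "x \<in> gen_submodule R M X" using subsetD[OF gen_submodule_superset that] .
        then obtain w where w: "w \<in> carrier ?F" "x = g w" using gX by blast
        let ?v = "w(n := \<zero>)"
        have "restrict ?v {..<n} = w" using w(1) by (auto simp: fun_eq_iff PiE_iff extensional_def)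
        then have "x = f ?v" using w a Hom_closed[OF g w(1)] by (simp add: f_def)
        moreover have "?v \<in> carrier ?F'" using w(1) by (auto simp: PiE_iff extensional_def)
        ultimately show ?thesis by blast
      qed
      ultimately show "insert a X \<subseteq> f ` carrier ?F'" by blast
    qed
  qed
  then have "restrict f (carrier ?F') ` carrier ?F' = ?G" by simp
  then show ?case using f by blast
qed

end

locale noetherian_cring = cring R + noetherian_ring R for R (structure)
begin

lemma fin_gen_ideal:
  assumes "ideal I R"
  shows "fin_gen R (regular_module R) I"
proof -
  obtain A where A: "A \<subseteq> carrier R" "finite A" "I = genideal R A"
    using finetely_gen[OF assms] by blast
  have "genideal R A = gen_submodule R (regular_module R) A"
    by (simp add: genideal_def gen_submodule_def submodule_regular_iff_ideal)
  then show ?thesis using A by (auto simp: fin_gen_def)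
qed

text \<open>\<open>R\<^sup>n\<close> is a noetherian module.\<close>

lemma fin_gen_submodule_free:
  "submodule K R (free_module R n) \<Longrightarrow> fin_gen R (free_module R n) K"
proof (induction n arbitrary: K)
  case 0
  let ?F = "free_module R 0"
  have carrier: "carrier ?F = {\<zero>\<^bsub>?F\<^esub>}" by (simp add: restrict_def)
  have "N = {\<zero>\<^bsub>?F\<^esub>}" if "submodule N R ?F" for N
  proof -
    have "N \<subseteq> carrier ?F" "\<zero>\<^bsub>?F\<^esub> \<in> N"
      using that unfolding submodule_iff[OF module_free] by blast+
    then show ?thesis unfolding carrier by blast
  qed
  moreover have "submodule (gen_submodule R (free_module R 0) {}) R (free_module R 0)"
    by (intro submodule_gen_submodule module_free) auto
  ultimately have "K = gen_submodule R (free_module R 0) {}" using 0 by metis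
  then show ?case unfolding fin_gen_def by blast
next
  case (Suc n)
  let ?F = "free_module R n" and ?F' = "free_module R (Suc n)"
  \<comment> \<open>the last coordinate, whose image of \<open>K\<close> is an ideal, and the inclusion \<open>R\<^sup>n \<rightarrow> R\<^sup>n\<^sup>+\<^sup>1\<close> onto its kernel\<close>
  define p where "p = restrict (\<lambda>v. v n) (carrier ?F')"
  have p: "p \<in> Hom R ?F' (regular_module R)"
    unfolding p_def by (intro HomI) (auto simp: module_free)
  define j where "j = restrict (\<lambda>v. v(n := \<zero>)) (carrier ?F)"
  have j: "j \<in> Hom R ?F ?F'"
    unfolding j_def
    by (intro HomI) (auto simp: module_free PiE_iff extensional_def fun_eq_iff)
  show ?case
  proof (rule fin_gen_if_image_and_ker[OF module_free module_regular p Suc.prems])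
    show "fin_gen R (regular_module R) (p ` K)"
      using submodule_image[OF module_free module_regular p Suc.prems]
      by (simp add: submodule_regular_iff_ideal fin_gen_ideal)
    let ?K = "{v \<in> carrier ?F. j v \<in> K}"
    have "fin_gen R ?F' (j ` ?K)"
      by (intro fin_gen_image[OF module_free module_free j] Suc.IH
          submodule_preimage[OF module_free module_free j Suc.prems])
    also have "j ` ?K = K \<inter> module_ker ?F' (regular_module R) p"
    proof
      show "j ` ?K \<subseteq> K \<inter> module_ker ?F' (regular_module R) p"
      proof (rule image_subsetI)
        fix v assume "v \<in> ?K"
        then have v: "v \<in> carrier ?F" "j v \<in> K" by simp_all
        have "j v \<in> carrier ?F'" using Hom_closed[OF j v(1)] .
        moreover have "j v n = \<zero>" using v(1) by (simp add: j_def)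
        ultimately have "p (j v) = \<zero>" by (simp add: p_def del: free_module_simps)
        with \<open>j v \<in> carrier ?F'\<close> v(2) show "j v \<in> K \<inter> module_ker ?F' (regular_module R) p"
          by (simp add: mem_module_ker del: free_module_simps)
      qed
      show "K \<inter> module_ker ?F' (regular_module R) p \<subseteq> j ` ?K"
      proof
        fix v assume v: "v \<in> K \<inter> module_ker ?F' (regular_module R) p"
        let ?w = "restrict v {..<n}"
        have v': "v \<in> carrier ?F'" "p v = \<zero>"
          using v by (simp_all add: mem_module_ker del: free_module_simps)
        then have "v n = \<zero>" by (simp add: p_def del: free_module_simps)
        with v'(1) have w: "?w \<in> carrier ?F" "j ?w = v"
          by (simp_all add: j_def PiE_iff extensional_def fun_eq_iff less_Suc_eq)
        then have "?w \<in> ?K" using v by simp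
        then show "v \<in> j ` ?K" using w(2) by (metis imageI)
      qed
    qed
    finally show "fin_gen R ?F' (K \<inter> module_ker ?F' (regular_module R) p)" .
  qed
qed

lemma finitely_presented_iff_fin_gen:
  fixes M :: "('a, 'm) module"
  shows "finitely_presented R M \<longleftrightarrow> module R M \<and> fin_gen R M (carrier M)"
proof (intro iffI conjI)
  assume "finitely_presented R M"
  then obtain n g where M: "module R M" and g: "g \<in> Hom R (free_module R n) M"
      "g ` carrier (free_module R n) = carrier M"
    by (auto simp: finitely_presented_def)
  show "module R M" by fact
  show "fin_gen R M (carrier M)"
    using fin_gen_image[OF module_free M g(1) fin_gen_submodule_free[OF submodule_carrier[OF module_free]]]
    unfolding g(2) .
next
  assume "module R M \<and> fin_gen R M (carrier M)"
  then obtain X where M: "module R M" and X: "finite X" "X \<subseteq> carrier M"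
      "carrier M = gen_submodule R M X"
    by (auto simp: fin_gen_def)
  obtain n g where g: "g \<in> Hom R (free_module R n) M" "g ` carrier (free_module R n) = carrier M"
    using free_module_onto_gen_submodule[OF M X(1,2)] X(3) by auto
  have "fin_gen R (free_module R n) (module_ker (free_module R n) M g)"
    by (intro fin_gen_submodule_free submodule_ker module_free M g)
  then obtain Y where Y: "finite Y" "Y \<subseteq> carrier (free_module R n)"
      "module_ker (free_module R n) M g = gen_submodule R (free_module R n) Y"
    by (auto simp: fin_gen_def)
  obtain m f where f: "f \<in> Hom R (free_module R m) (free_module R n)"
      "f ` carrier (free_module R m) = module_ker (free_module R n) M g"
    using free_module_onto_gen_submodule[OF module_free Y(1,2)] Y(3) by auto
  show "finitely_presented R M"
    unfolding finitely_presented_def using M f g by metis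
qed

lemma mod_fp_iff: "M \<in> mod_fp R \<longleftrightarrow> module R M \<and> fin_gen R M (carrier M)"
  by (simp add: mod_fp_def finitely_presented_iff_fin_gen)

lemma mod_fp_image:
  assumes "module R M" "fin_gen R M (carrier M)" "module R N" "h \<in> Hom R M N"
    and "h ` carrier M = carrier N"
  shows "N \<in> mod_fp R"
  using fin_gen_image[OF assms(1,3,4,2)] assms(3,5) by (simp add: mod_fp_iff)

end

section \<open>Cyclic modules and supports\<close>

text \<open>
  The module \<open>R/I\<close> together with the projection \<open>R \<rightarrow> R/I\<close>, realised on sets of sequences of ring
  elements: a representative \<open>x\<close> becomes the singleton of the constant sequence \<open>x\<close>.
\<close>

definition cyclic_module :: "('a, 'r) ring_scheme \<Rightarrow> 'a set \<Rightarrow> ('a, 'a elem) module"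
  where "cyclic_module R I = quot (\<lambda>x. {\<lambda>_. x}) (regular_module R) I"

definition cyclic_map :: "('a, 'r) ring_scheme \<Rightarrow> 'a set \<Rightarrow> 'a \<Rightarrow> 'a elem"
  where "cyclic_map R I = quot_map (\<lambda>x. {\<lambda>_. x}) (regular_module R) I"

text \<open>The annihilator of an element \<open>x\<close> of \<open>M\<close>.\<close>

definition ann :: "('a, 'r) ring_scheme \<Rightarrow> ('a, 'm) module \<Rightarrow> 'm \<Rightarrow> 'a set"
  where "ann R M x = {r \<in> carrier R. r \<odot>\<^bsub>M\<^esub> x = \<zero>\<^bsub>M\<^esub>}"

text \<open>
  The support: \<open>M\<close> localised at \<open>P\<close> is nonzero iff some element of \<open>M\<close> is killed by no element
  outside \<open>P\<close>.
\<close>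

definition supp :: "('a, 'r) ring_scheme \<Rightarrow> ('a, 'm) module \<Rightarrow> 'a set set"
  where "supp R M = {P \<in> Spec R. \<exists>x\<in>carrier M. ann R M x \<subseteq> P}"

context cring
begin

lemma cyclic_module_properties:
  assumes "ideal I R"
  shows module_cyclic: "module R (cyclic_module R I)"
    and cyclic_map_Hom: "cyclic_map R I \<in> Hom R (regular_module R) (cyclic_module R I)"
    and cyclic_map_surj: "cyclic_map R I ` carrier R = carrier (cyclic_module R I)"
    and cyclic_map_ker: "module_ker (regular_module R) (cyclic_module R I) (cyclic_map R I) = I"
proof -
  have I: "submodule I R (regular_module R)"
    using assms by (simp add: submodule_regular_iff_ideal)
  have inj: "inj (\<lambda>x :: 'a. {\<lambda>_ :: nat. x})"
    by (rule injI) (metis singleton_inject)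
  note q = quot_properties[OF module_regular I inj]
  show "module R (cyclic_module R I)"
    "cyclic_map R I \<in> Hom R (regular_module R) (cyclic_module R I)"
    "cyclic_map R I ` carrier R = carrier (cyclic_module R I)"
    "module_ker (regular_module R) (cyclic_module R I) (cyclic_map R I) = I"
    using q by (simp_all add: cyclic_module_def cyclic_map_def)
qed

lemma cyclic_map_eq_zero_iff:
  assumes "ideal I R" "r \<in> carrier R"
  shows "cyclic_map R I r = \<zero>\<^bsub>cyclic_module R I\<^esub> \<longleftrightarrow> r \<in> I"
  using cyclic_map_ker[OF assms(1)] assms(2) by (auto simp: module_ker_def)

lemma cyclic_map_mult:
  assumes "ideal I R" "r \<in> carrier R" "s \<in> carrier R"
  shows "r \<odot>\<^bsub>cyclic_module R I\<^esub> cyclic_map R I s = cyclic_map R I (r \<otimes> s)"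
  using Hom_smult[OF cyclic_map_Hom[OF assms(1)], of r s] assms(2,3) by simp

lemma cyclic_map_closed:
  assumes "ideal I R" "r \<in> carrier R"
  shows "cyclic_map R I r \<in> carrier (cyclic_module R I)"
  using Hom_closed[OF cyclic_map_Hom[OF assms(1)], of r] assms(2) by simp

lemma ann_eq_ker:
  "ann R M x = module_ker (regular_module R) M (\<lambda>r\<in>carrier R. r \<odot>\<^bsub>M\<^esub> x)"
  by (auto simp: ann_def module_ker_def)

lemma ideal_ann:
  fixes M :: "('a, 'm) module"
  assumes "module R M" "x \<in> carrier M"
  shows "ideal (ann R M x) R"
  using submodule_ker[OF module_regular assms(1) Hom_regular[OF assms]]
  by (simp add: ann_eq_ker submodule_regular_iff_ideal)

lemma ann_cyclic:
  assumes "ideal I R" "s \<in> carrier R"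
  shows "ann R (cyclic_module R I) (cyclic_map R I s) = {r \<in> carrier R. r \<otimes> s \<in> I}"
  unfolding ann_def
  by (rule Collect_cong) (use assms in \<open>simp add: cyclic_map_mult cyclic_map_eq_zero_iff cong: conj_cong\<close>)

text \<open>The isomorphism \<open>R/ann x \<cong> Rx\<close>, as an embedding into \<open>M\<close>.\<close>

lemma cyclic_embedding:
  fixes M :: "('a, 'm) module"
  assumes M: "module R M" and x: "x \<in> carrier M"
  obtains k where "k \<in> Hom R (cyclic_module R (ann R M x)) M"
    and "inj_on k (carrier (cyclic_module R (ann R M x)))"
    and "k ` carrier (cyclic_module R (ann R M x)) = (\<lambda>r. r \<odot>\<^bsub>M\<^esub> x) ` carrier R"
    and "\<forall>r\<in>carrier R. k (cyclic_map R (ann R M x) r) = r \<odot>\<^bsub>M\<^esub> x"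
proof -
  let ?I = "ann R M x" and ?C = "cyclic_module R (ann R M x)"
  note I = ideal_ann[OF M x]
  obtain k where k: "k \<in> Hom R ?C M"
    and k_map: "\<forall>r\<in>carrier (regular_module R).
      k (cyclic_map R ?I r) = (\<lambda>r\<in>carrier R. r \<odot>\<^bsub>M\<^esub> x) r"
    by (rule Hom_factor[OF module_regular module_cyclic[OF I] M cyclic_map_Hom[OF I] _
          Hom_regular[OF M x]])
      (simp_all add: cyclic_map_surj[OF I] cyclic_map_ker[OF I] ann_eq_ker[of M x, symmetric])
  have k_eq: "k (cyclic_map R ?I r) = r \<odot>\<^bsub>M\<^esub> x" if "r \<in> carrier R" for r
    using k_map that by simp
  have "module_ker ?C M k \<subseteq> {\<zero>\<^bsub>?C\<^esub>}"
  proof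
    fix u assume u: "u \<in> module_ker ?C M k"
    then obtain r where r: "r \<in> carrier R" "u = cyclic_map R ?I r"
      using cyclic_map_surj[OF I] by (auto simp: module_ker_def)
    then have "r \<in> ?I" using u k_eq by (simp add: module_ker_def ann_def)
    then show "u \<in> {\<zero>\<^bsub>?C\<^esub>}" using r cyclic_map_eq_zero_iff[OF I] by simp
  qed
  then have "inj_on k (carrier ?C)" using Hom_inj_iff[OF module_cyclic[OF I] M k] by blast
  moreover have "k ` carrier ?C = (\<lambda>r. r \<odot>\<^bsub>M\<^esub> x) ` carrier R"
    unfolding cyclic_map_surj[OF I, symmetric] image_image using k_eq by (intro image_cong) auto
  ultimately show thesis using that k k_eq by blast
qed

lemma supp_subobject:
  assumes A: "module R A" and B: "module R B" and f: "f \<in> Hom R A B" "inj_on f (carrier A)"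
  shows "supp R A \<subseteq> supp R B"
proof
  fix P assume "P \<in> supp R A"
  then obtain x where x: "x \<in> carrier A" and P: "P \<in> Spec R" "ann R A x \<subseteq> P"
    by (auto simp: supp_def)
  interpret A: module R A by fact
  have "ann R B (f x) \<subseteq> ann R A x"
  proof
    fix r assume "r \<in> ann R B (f x)"
    then have r: "r \<in> carrier R" "r \<odot>\<^bsub>B\<^esub> f x = \<zero>\<^bsub>B\<^esub>" by (auto simp: ann_def)
    then have "f (r \<odot>\<^bsub>A\<^esub> x) = f \<zero>\<^bsub>A\<^esub>"
      using Hom_smult[OF f(1) r(1) x] Hom_zero[OF A B f(1)] by simp
    then show "r \<in> ann R A x"
      using inj_onD[OF f(2)] r(1) x by (simp add: ann_def)
  qed
  then show "P \<in> supp R B"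
    using P Hom_closed[OF f(1) x] by (auto simp: supp_def)
qed

lemma supp_quotient:
  assumes B: "module R B" and C: "module R C" and g: "g \<in> Hom R B C" "g ` carrier B = carrier C"
  shows "supp R C \<subseteq> supp R B"
proof
  fix P assume "P \<in> supp R C"
  then obtain x where x: "x \<in> carrier B" and P: "P \<in> Spec R" "ann R C (g x) \<subseteq> P"
    unfolding supp_def g(2)[symmetric] by blast
  have "ann R B x \<subseteq> ann R C (g x)"
    using Hom_smult[OF g(1) _ x] Hom_zero[OF B C g(1)] by (auto simp: ann_def) metis
  then show "P \<in> supp R B"
    using P x by (auto simp: supp_def)
qed

text \<open>
  If \<open>P\<close> lies in neither outer support, then \<open>b \<in> B\<close> is killed modulo \<open>A\<close> by some \<open>s \<notin> P\<close>, and \<open>s b\<close>, which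
  comes from \<open>A\<close>, is killed by some \<open>t \<notin> P\<close>; so \<open>t s \<notin> P\<close> kills \<open>b\<close>.
\<close>

lemma supp_extension:
  assumes A: "module R A" and B: "module R B" and C: "module R C"
    and exact: "short_exact R A f B g C"
  shows "supp R B \<subseteq> supp R A \<union> supp R C"
proof
  interpret B: module R B by fact
  have f: "f \<in> Hom R A B" and g: "g \<in> Hom R B C" and ker: "f ` carrier A = module_ker B C g"
    using exact by (auto simp: short_exact_def)
  fix P assume "P \<in> supp R B"
  then obtain b where b: "b \<in> carrier B" "ann R B b \<subseteq> P" and P: "P \<in> Spec R"
    by (auto simp: supp_def)
  interpret P: primeideal P R using P by (simp add: Spec_def)
  show "P \<in> supp R A \<union> supp R C"
  proof (rule ccontr)
    assume "P \<notin> supp R A \<union> supp R C"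
    then have not: "\<And>a. a \<in> carrier A \<Longrightarrow> \<not> ann R A a \<subseteq> P" "\<not> ann R C (g b) \<subseteq> P"
      using P Hom_closed[OF g b(1)] by (auto simp: supp_def)
    then obtain s where s: "s \<in> carrier R" "s \<odot>\<^bsub>C\<^esub> g b = \<zero>\<^bsub>C\<^esub>" "s \<notin> P" by (auto simp: ann_def)
    then have "s \<odot>\<^bsub>B\<^esub> b \<in> module_ker B C g"
      using Hom_smult[OF g s(1) b(1)] b(1) by (simp add: module_ker_def)
    then obtain a where a: "a \<in> carrier A" "s \<odot>\<^bsub>B\<^esub> b = f a" using ker by blast
    then obtain t where t: "t \<in> carrier R" "t \<odot>\<^bsub>A\<^esub> a = \<zero>\<^bsub>A\<^esub>" "t \<notin> P"
      using not(1)[OF a(1)] by (auto simp: ann_def)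
    have "(t \<otimes> s) \<odot>\<^bsub>B\<^esub> b = t \<odot>\<^bsub>B\<^esub> f a"
      using t(1) s(1) b(1) by (simp add: B.smult_assoc1 a(2))
    also have "\<dots> = \<zero>\<^bsub>B\<^esub>"
      using Hom_smult[OF f t(1) a(1)] t(2) Hom_zero[OF A B f] by simp
    finally have "t \<otimes> s \<in> P" using b(2) t(1) s(1) by (auto simp: ann_def)
    then show False using P.I_prime t(1,3) s(1,3) by blast
  qed
qed

lemma supp_zero:
  fixes Z :: "('a, 'm) module"
  assumes Z: "module R Z" and zero: "carrier Z = {\<zero>\<^bsub>Z\<^esub>}"
  shows "supp R Z = {}"
proof -
  interpret Z: module R Z by fact
  have "ann R Z \<zero>\<^bsub>Z\<^esub> = carrier R" by (auto simp: ann_def)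
  moreover have "\<not> carrier R \<subseteq> P" if "P \<in> Spec R" for P
  proof -
    interpret P: primeideal P R using that by (simp add: Spec_def)
    show ?thesis using P.I_notcarr P.a_subset by blast
  qed
  ultimately show ?thesis unfolding supp_def zero by auto
qed

lemma supp_cyclic:
  assumes I: "ideal I R"
  shows "supp R (cyclic_module R I) = {P \<in> Spec R. I \<subseteq> P}"
proof -
  interpret I: ideal I R by fact
  have le: "I \<subseteq> ann R (cyclic_module R I) (cyclic_map R I s)" if "s \<in> carrier R" for s
    using that I.a_subset I.I_r_closed by (auto simp: ann_cyclic[OF I])
  have one: "ann R (cyclic_module R I) (cyclic_map R I \<one>) = I"
    using I.a_subset by (auto simp: ann_cyclic[OF I] subset_iff)
  show ?thesis
  proof (intro equalityI subsetI)
    fix P assume "P \<in> supp R (cyclic_module R I)"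
    then obtain s where "s \<in> carrier R" "P \<in> Spec R"
        "ann R (cyclic_module R I) (cyclic_map R I s) \<subseteq> P"
      unfolding supp_def cyclic_map_surj[OF I, symmetric] by blast
    then show "P \<in> {P \<in> Spec R. I \<subseteq> P}" using le by blast
  next
    fix P assume "P \<in> {P \<in> Spec R. I \<subseteq> P}"
    then show "P \<in> supp R (cyclic_module R I)"
      using bexI[OF _ cyclic_map_closed[OF I one_closed],
          of "\<lambda>x. ann R (cyclic_module R I) x \<subseteq> P"] one
      by (simp add: supp_def)
  qed
qed

end

section \<open>Serre subcategories are determined by the primes they contain\<close>

lemma serre_subset: "serre_subcategory R S \<Longrightarrow> S \<subseteq> mod_fp R"
  by (simp add: serre_subcategory_def)

lemma serre_zero: "\<lbrakk>serre_subcategory R S; Z \<in> mod_fp R; carrier Z = {\<zero>\<^bsub>Z\<^esub>}\<rbrakk> \<Longrightarrow> Z \<in> S"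
  by (simp add: serre_subcategory_def)

lemma serre_subobject:
  assumes "serre_subcategory R S" "B \<in> S" "A \<in> mod_fp R" "f \<in> Hom R A B" "inj_on f (carrier A)"
  shows "A \<in> S"
  using assms(1)[unfolded serre_subcategory_def, THEN conjunct2, THEN conjunct2, THEN conjunct1]
    assms(2-) by blast

lemma serre_quotient:
  assumes "serre_subcategory R S" "B \<in> S" "C \<in> mod_fp R" "g \<in> Hom R B C"
    "g ` carrier B = carrier C"
  shows "C \<in> S"
  using assms(1)[unfolded serre_subcategory_def, THEN conjunct2, THEN conjunct2, THEN conjunct2,
      THEN conjunct1] assms(2-) by blast

lemma serre_extension:
  assumes "serre_subcategory R S" "A \<in> S" "C \<in> S" "B \<in> mod_fp R" "short_exact R A f B g C"
  shows "B \<in> S"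
  using assms(1)[unfolded serre_subcategory_def, THEN conjunct2, THEN conjunct2, THEN conjunct2,
      THEN conjunct2] assms(2-) by blast

context noetherian_cring
begin

lemma mod_fp_module: "M \<in> mod_fp R \<Longrightarrow> module R M"
  by (simp add: mod_fp_iff)

lemma cyclic_mod_fp: "ideal I R \<Longrightarrow> cyclic_module R I \<in> mod_fp R"
  using mod_fp_image[OF module_regular _ module_cyclic cyclic_map_Hom]
    fin_gen_ideal[OF oneideal] cyclic_map_surj by simp

text \<open>
  With \<open>T = {P}\<close> this is the subcategory attached to a prime; with \<open>T\<close> the set of primes not containing
  \<open>I\<close> it consists of the modules supported on \<open>V(I)\<close>.
\<close>

lemma serre_avoiding_supports: "serre_subcategory R {A \<in> mod_fp R. supp R A \<inter> T = {}}"
  unfolding serre_subcategory_def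
proof (intro conjI ballI allI impI)
  fix Z :: "('a, 'a elem) module" assume "Z \<in> mod_fp R" "carrier Z = {\<zero>\<^bsub>Z\<^esub>}"
  then show "Z \<in> {A \<in> mod_fp R. supp R A \<inter> T = {}}"
    using supp_zero[of Z] mod_fp_module[of Z] by simp
next
  fix A B f assume "A \<in> mod_fp R" "B \<in> {A \<in> mod_fp R. supp R A \<inter> T = {}}" "f \<in> Hom R A B"
    "inj_on f (carrier A)"
  then show "A \<in> {A \<in> mod_fp R. supp R A \<inter> T = {}}"
    using supp_subobject[of A B f] mod_fp_module by blast
next
  fix B C g assume "B \<in> {A \<in> mod_fp R. supp R A \<inter> T = {}}" "C \<in> mod_fp R" "g \<in> Hom R B C"
    "g ` carrier B = carrier C"
  then show "C \<in> {A \<in> mod_fp R. supp R A \<inter> T = {}}"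
    using supp_quotient[of B C g] mod_fp_module by blast
next
  fix A B C f g assume "A \<in> {A \<in> mod_fp R. supp R A \<inter> T = {}}" "B \<in> mod_fp R"
    "C \<in> {A \<in> mod_fp R. supp R A \<inter> T = {}}" "short_exact R A f B g C"
  then show "B \<in> {A \<in> mod_fp R. supp R A \<inter> T = {}}"
    using supp_extension[of A B C f g] mod_fp_module by blast
qed blast

lemma cyclic_quotient_map:
  assumes I: "ideal I R" and J: "ideal J R" and IJ: "I \<subseteq> J"
  obtains g where "g \<in> Hom R (cyclic_module R I) (cyclic_module R J)"
    and "g ` carrier (cyclic_module R I) = carrier (cyclic_module R J)"
    and "\<forall>r\<in>carrier R. g (cyclic_map R I r) = cyclic_map R J r"
proof -
  obtain g where g: "g \<in> Hom R (cyclic_module R I) (cyclic_module R J)"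
    and "\<forall>r\<in>carrier (regular_module R). g (cyclic_map R I r) = cyclic_map R J r"
    by (rule Hom_factor[OF module_regular module_cyclic[OF I] module_cyclic[OF J] cyclic_map_Hom[OF I]
          _ cyclic_map_Hom[OF J]])
      (use IJ in \<open>simp_all add: cyclic_map_surj[OF I] cyclic_map_ker[OF I] cyclic_map_ker[OF J]\<close>)
  then have eq: "\<forall>r\<in>carrier R. g (cyclic_map R I r) = cyclic_map R J r" by simp
  have "g ` carrier (cyclic_module R I) = carrier (cyclic_module R J)"
    unfolding cyclic_map_surj[OF I, symmetric] cyclic_map_surj[OF J, symmetric] image_image
    using eq by (intro image_cong) auto
  then show thesis using that g eq by blast
qed

lemma serre_cyclic_mono:
  assumes "serre_subcategory R S" "ideal I R" "ideal J R" "I \<subseteq> J" "cyclic_module R I \<in> S"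
  shows "cyclic_module R J \<in> S"
proof -
  obtain g where "g \<in> Hom R (cyclic_module R I) (cyclic_module R J)"
    "g ` carrier (cyclic_module R I) = carrier (cyclic_module R J)"
    by (rule cyclic_quotient_map[OF assms(2-4)])
  then show ?thesis by (rule serre_quotient[OF assms(1,5) cyclic_mod_fp[OF assms(3)]])
qed

text \<open>Closure under extensions, applied to \<open>0 \<rightarrow> R/ann x \<rightarrow> A \<rightarrow> A/Rx \<rightarrow> 0\<close>.\<close>

lemma serre_cyclic_extension:
  assumes S: "serre_subcategory R S" and A: "A \<in> mod_fp R" and x: "x \<in> carrier A"
    and sub: "cyclic_module R (ann R A x) \<in> S"
    and C: "C \<in> S" and g: "g \<in> Hom R A C" "g ` carrier A = carrier C"
    and ker: "module_ker A C g = (\<lambda>r. r \<odot>\<^bsub>A\<^esub> x) ` carrier R"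
  shows "A \<in> S"
proof -
  obtain k where "k \<in> Hom R (cyclic_module R (ann R A x)) A"
    "inj_on k (carrier (cyclic_module R (ann R A x)))"
    "k ` carrier (cyclic_module R (ann R A x)) = (\<lambda>r. r \<odot>\<^bsub>A\<^esub> x) ` carrier R"
    by (rule cyclic_embedding[OF mod_fp_module[OF A] x])
  then have "short_exact R (cyclic_module R (ann R A x)) k A g C"
    using g ker by (simp add: short_exact_def)
  then show ?thesis using serre_extension[OF S sub C A] by blast
qed

lemma exists_maximal_ideal_in:
  assumes "I \<in> \<I>" "\<And>J. J \<in> \<I> \<Longrightarrow> ideal J R"
  obtains M where "M \<in> \<I>" "\<And>J. \<lbrakk>J \<in> \<I>; M \<subseteq> J\<rbrakk> \<Longrightarrow> J = M"
proof -
  have "\<exists>M\<in>\<I>. \<forall>J\<in>\<I>. M \<subseteq> J \<longrightarrow> J = M"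
  proof (rule subset_Zorn)
    fix C assume C: "subset.chain \<I> C"
    show "\<exists>U\<in>\<I>. \<forall>J\<in>C. J \<subseteq> U"
    proof (cases "C = {}")
      case True
      then show ?thesis using assms(1) by blast
    next
      case False
      have "subset.chain {I. ideal I R} C" using C assms(2) by (auto simp: subset.chain_def)
      then have "\<Union>C \<in> C" using ideal_chain_is_trivial False by blast
      then show ?thesis using C by (auto simp: subset.chain_def)
    qed
  qed
  then show thesis using that by blast
qed

text \<open>
  An ideal \<open>M\<close> maximal among those containing \<open>I\<close> with \<open>R/M \<notin> S\<close> is prime. The ideal \<open>(M : a)\<close> enters as the
  annihilator of the class of \<open>a\<close> in \<open>R/M\<close>.
\<close>

lemma exists_prime_not_in_serre:
  assumes S: "serre_subcategory R S" and I: "ideal I R" "cyclic_module R I \<notin> S"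
  obtains P where "P \<in> Spec R" "I \<subseteq> P" "cyclic_module R P \<notin> S"
proof -
  let ?\<I> = "{J. ideal J R \<and> I \<subseteq> J \<and> cyclic_module R J \<notin> S}"
  obtain M where "M \<in> ?\<I>" and max: "\<And>J. \<lbrakk>J \<in> ?\<I>; M \<subseteq> J\<rbrakk> \<Longrightarrow> J = M"
    by (rule exists_maximal_ideal_in[of I ?\<I>]) (use I in auto)
  then have M: "ideal M R" "I \<subseteq> M" "cyclic_module R M \<notin> S" by auto
  interpret M: ideal M R by fact
  let ?C = "cyclic_module R M" and ?\<pi> = "cyclic_map R M"
  have bigger: "cyclic_module R J \<in> S" if "ideal J R" "M \<subseteq> J" "c \<in> J" "c \<notin> M" for J c
    using max[of J] that M(2) by blast
  have "primeideal M R"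
  proof (rule primeidealI)
    show "carrier R \<noteq> M"
    proof
      assume "carrier R = M"
      then have "?\<pi> r = \<zero>\<^bsub>?C\<^esub>" if "r \<in> carrier R" for r
        using cyclic_map_eq_zero_iff[OF M(1)] that by blast
      then have "carrier ?C = {\<zero>\<^bsub>?C\<^esub>}"
        unfolding cyclic_map_surj[OF M(1), symmetric] using zero_closed by force
      then show False using serre_zero[OF S cyclic_mod_fp[OF M(1)]] M(3) by blast
    qed
  next
    fix a b assume ab: "a \<in> carrier R" "b \<in> carrier R" "a \<otimes> b \<in> M"
    show "a \<in> M \<or> b \<in> M"
    proof (rule ccontr)
      assume "\<not> (a \<in> M \<or> b \<in> M)"
      then have not: "a \<notin> M" "b \<notin> M" by auto
      note \<pi>a = cyclic_map_closed[OF M(1) ab(1)] and modC = module_cyclic[OF M(1)]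
      have "M \<subseteq> ann R ?C (?\<pi> a)" "b \<in> ann R ?C (?\<pi> a)"
        using ab M.I_r_closed M.a_subset m_comm by (auto simp: ann_cyclic[OF M(1)])
      then have sub: "cyclic_module R (ann R ?C (?\<pi> a)) \<in> S"
        using bigger[OF ideal_ann[OF modC \<pi>a]] not(2) by blast
      \<comment> \<open>the ideal \<open>M + Ra\<close>\<close>
      define J where "J = {r \<in> carrier R. ?\<pi> r \<in> (\<lambda>s. s \<odot>\<^bsub>?C\<^esub> ?\<pi> a) ` carrier R}"
      have J: "ideal J R"
        using submodule_preimage[OF module_regular modC cyclic_map_Hom[OF M(1)]
            Hom_cyclic_submodule[OF modC \<pi>a]]
        by (simp add: J_def submodule_regular_iff_ideal)
      have "\<zero> \<odot>\<^bsub>?C\<^esub> ?\<pi> a = \<zero>\<^bsub>?C\<^esub>" using module.smult_l_null[OF modC \<pi>a] .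
      then have "?\<pi> r = \<zero> \<odot>\<^bsub>?C\<^esub> ?\<pi> a" if "r \<in> M" for r
        using that M.a_subset by (simp add: cyclic_map_eq_zero_iff[OF M(1)] subset_iff)
      then have MJ: "M \<subseteq> J" unfolding J_def using M.a_subset by blast
      have "?\<pi> a = \<one> \<odot>\<^bsub>?C\<^esub> ?\<pi> a" using ab(1) by (simp add: cyclic_map_mult[OF M(1)])
      then have "a \<in> J" unfolding J_def using ab(1) by blast
      then have CJ: "cyclic_module R J \<in> S" using bigger[OF J MJ] not(1) by blast
      obtain g where g: "g \<in> Hom R ?C (cyclic_module R J)"
          "g ` carrier ?C = carrier (cyclic_module R J)"
        and g_map: "\<forall>r\<in>carrier R. g (?\<pi> r) = cyclic_map R J r"
        by (rule cyclic_quotient_map[OF M(1) J MJ])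
      have "module_ker ?C (cyclic_module R J) g = ?\<pi> ` J"
      proof -
        have J_sub: "J \<subseteq> carrier R" by (auto simp: J_def)
        have "g (?\<pi> r) = \<zero>\<^bsub>cyclic_module R J\<^esub> \<longleftrightarrow> r \<in> J" if "r \<in> carrier R" for r
          using g_map cyclic_map_eq_zero_iff[OF J that] that by simp
        then show ?thesis
          unfolding module_ker_def cyclic_map_surj[OF M(1), symmetric] using J_sub by blast
      qed
      also have "\<dots> = (\<lambda>s. s \<odot>\<^bsub>?C\<^esub> ?\<pi> a) ` carrier R"
      proof
        show "?\<pi> ` J \<subseteq> (\<lambda>s. s \<odot>\<^bsub>?C\<^esub> ?\<pi> a) ` carrier R" by (auto simp: J_def)
        show "(\<lambda>s. s \<odot>\<^bsub>?C\<^esub> ?\<pi> a) ` carrier R \<subseteq> ?\<pi> ` J"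
        proof (rule image_subsetI)
          fix s assume s: "s \<in> carrier R"
          then have "s \<odot>\<^bsub>?C\<^esub> ?\<pi> a = ?\<pi> (s \<otimes> a)" using ab(1) by (simp add: cyclic_map_mult[OF M(1)])
          moreover from this have "s \<otimes> a \<in> J" unfolding J_def using s ab(1) by (auto intro: image_eqI)
          ultimately show "s \<odot>\<^bsub>?C\<^esub> ?\<pi> a \<in> ?\<pi> ` J" by blast
        qed
      qed
      finally have "?C \<in> S"
        using serre_cyclic_extension[OF S cyclic_mod_fp[OF M(1)] \<pi>a sub CJ g] by blast
      then show False using M(3) by blast
    qed
  qed (use M(1) cring_axioms in auto)
  then show thesis using that M(2,3) by (simp add: Spec_def)
qed

text \<open>
  Induction on the number of generators of \<open>A\<close>: for a generator \<open>x\<close>, both \<open>R/ann x\<close> and \<open>A/Rx\<close> have their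
  supports inside that of \<open>A\<close>.
\<close>

lemma serre_if_primes_of_supp_generated:
  assumes S: "serre_subcategory R S"
  shows "\<lbrakk>A \<in> mod_fp R; finite X; card X \<le> n; X \<subseteq> carrier A; carrier A = gen_submodule R A X;
    \<And>P. P \<in> supp R A \<Longrightarrow> cyclic_module R P \<in> S\<rbrakk> \<Longrightarrow> A \<in> S"
proof (induction n arbitrary: A X)
  case 0
  note A = mod_fp_module[OF "0.prems"(1)]
  have "X = {}" using 0 by simp
  then have "carrier A \<subseteq> {\<zero>\<^bsub>A\<^esub>}"
    using "0.prems"(5) gen_submodule_least[OF submodule_zero[OF A], of X] by simp
  then have "carrier A = {\<zero>\<^bsub>A\<^esub>}"
    using submodule_zero[OF A] by (auto simp: submodule_iff[OF A])
  then show ?case using serre_zero[OF S] "0.prems"(1) by blast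
next
  case (Suc n)
  note A = mod_fp_module[OF Suc.prems(1)]
  show ?case
  proof (cases "card X \<le> n")
    case True
    show ?thesis by (rule Suc.IH[OF Suc.prems(1,2) True Suc.prems(4-6)])
  next
    case False
    then have "X \<noteq> {}" by auto
    then obtain x where x: "x \<in> X" by blast
    have xA: "x \<in> carrier A" using x Suc.prems(4) by blast
    interpret A: module R A by fact
    define q where "q = quot_map id A ((\<lambda>r. r \<odot>\<^bsub>A\<^esub> x) ` carrier R)"
    define Q where "Q = quot id A ((\<lambda>r. r \<odot>\<^bsub>A\<^esub> x) ` carrier R)"
    have Q: "module R Q" and q: "q \<in> Hom R A Q" "q ` carrier A = carrier Q"
      and ker: "module_ker A Q q = (\<lambda>r. r \<odot>\<^bsub>A\<^esub> x) ` carrier R"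
      using quot_properties[OF A Hom_cyclic_submodule[OF A xA], of id] by (simp_all add: q_def Q_def)
    have "\<one> \<odot>\<^bsub>A\<^esub> x \<in> module_ker A Q q" unfolding ker by blast
    then have qx: "q x = \<zero>\<^bsub>Q\<^esub>" using xA by (simp add: module_ker_def)
    let ?Y = "q ` (X - {x})"
    have Y: "?Y \<subseteq> carrier Q" using Suc.prems(4) q by blast
    have "carrier Q = gen_submodule R Q (q ` X)"
      using gen_submodule_image[OF A Q q(1) Suc.prems(4)] q(2) Suc.prems(5) by simp
    also have "\<dots> \<subseteq> gen_submodule R Q ?Y"
    proof (rule gen_submodule_least[OF submodule_gen_submodule[OF Q Y]])
      have "\<zero>\<^bsub>Q\<^esub> \<in> gen_submodule R Q ?Y"
        using submodule_gen_submodule[OF Q Y] by (simp add: submodule_iff[OF Q])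
      then show "q ` X \<subseteq> gen_submodule R Q ?Y"
        using subsetD[OF gen_submodule_superset[of ?Y Q]] qx by (intro image_subsetI) fastforce
    qed
    finally have gen: "carrier Q = gen_submodule R Q ?Y"
      using gen_submodule_least[OF submodule_carrier[OF Q] Y] by blast
    have "card ?Y \<le> n"
      using card_image_le[of "X - {x}" q] Suc.prems(2,3) x by (simp add: card_Diff_singleton)
    moreover have "Q \<in> mod_fp R"
      using mod_fp_image[OF A _ Q q] Suc.prems(1) by (simp add: mod_fp_iff)
    moreover have "cyclic_module R P \<in> S" if "P \<in> supp R Q" for P
      using that supp_quotient[OF A Q q] Suc.prems(6) by blast
    ultimately have "Q \<in> S"
      using Suc.IH[of Q ?Y] Suc.prems(2) Y gen by simp
    moreover have "cyclic_module R (ann R A x) \<in> S"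
    proof (rule ccontr)
      assume "cyclic_module R (ann R A x) \<notin> S"
      then obtain P where "P \<in> Spec R" "ann R A x \<subseteq> P" "cyclic_module R P \<notin> S"
        by (rule exists_prime_not_in_serre[OF S ideal_ann[OF A xA]])
      then show False using Suc.prems(6)[of P] xA by (auto simp: supp_def)
    qed
    ultimately show ?thesis
      using serre_cyclic_extension[OF S Suc.prems(1) xA _ _ q ker] by blast
  qed
qed

text \<open>A Serre subcategory is determined by the primes \<open>P\<close> with \<open>R/P\<close> in it.\<close>

theorem serre_iff_primes_of_supp:
  assumes S: "serre_subcategory R S"
  shows "A \<in> S \<longleftrightarrow> A \<in> mod_fp R \<and> (\<forall>P\<in>supp R A. cyclic_module R P \<in> S)"
proof (intro iffI conjI ballI)
  assume "A \<in> S"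
  then show A: "A \<in> mod_fp R" using serre_subset[OF S] by blast
  fix P assume "P \<in> supp R A"
  then obtain x where x: "x \<in> carrier A" "ann R A x \<subseteq> P" and "P \<in> Spec R"
    by (auto simp: supp_def)
  then have P: "ideal P R" by (simp add: Spec_def primeideal.axioms(1))
  note I = ideal_ann[OF mod_fp_module[OF A] x(1)]
  obtain k where "k \<in> Hom R (cyclic_module R (ann R A x)) A"
    "inj_on k (carrier (cyclic_module R (ann R A x)))"
    by (rule cyclic_embedding[OF mod_fp_module[OF A] x(1)])
  then have "cyclic_module R (ann R A x) \<in> S"
    by (rule serre_subobject[OF S \<open>A \<in> S\<close> cyclic_mod_fp[OF I]])
  then show "cyclic_module R P \<in> S" using serre_cyclic_mono[OF S I P x(2)] by blast
next
  assume A: "A \<in> mod_fp R \<and> (\<forall>P\<in>supp R A. cyclic_module R P \<in> S)"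
  then obtain X where "finite X" "X \<subseteq> carrier A" "carrier A = gen_submodule R A X"
    by (auto simp: mod_fp_iff fin_gen_def)
  then show "A \<in> S" using serre_if_primes_of_supp_generated[OF S, of A X "card X"] A by blast
qed

end

section \<open>Homomorphisms into an injective hull of a prime quotient\<close>

context cring
begin

text \<open>
  An embedding \<open>\<iota>\<close> of \<open>R/P\<close> composed with the projection from \<open>R\<close>. Only this composite \<open>e\<close> is used below,
  so that cosets do not occur any more.
\<close>

lemma quotient_module_embedding:
  fixes E :: "('a, 'e) module"
  assumes P: "ideal P R" and E: "module R E"
    and \<iota>: "\<iota> \<in> Hom R (quotient_module R P) E" "inj_on \<iota> (carrier (quotient_module R P))"
  obtains e where "e \<in> Hom R (regular_module R) E" "module_ker (regular_module R) E e = P"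
    and "e ` carrier R = \<iota> ` carrier (quotient_module R P)"
proof -
  interpret P: ideal P R by fact
  let ?Q = "quotient_module R P"
  have carrier: "carrier ?Q = (\<lambda>r. P +> r) ` carrier R"
    by (auto simp: quotient_module_def FactRing_def A_RCOSETS_def')
  have add: "(P +> r) \<oplus>\<^bsub>?Q\<^esub> (P +> s) = P +> (r \<oplus> s)" if "r \<in> carrier R" "s \<in> carrier R" for r s
    using P.a_rcos_sum[OF that] by (simp add: quotient_module_def FactRing_def)
  have smult: "r \<odot>\<^bsub>?Q\<^esub> (P +> s) = P +> (r \<otimes> s)" if "r \<in> carrier R" "s \<in> carrier R" for r s
    using P.rcoset_mult_add[OF that] by (simp add: quotient_module_def FactRing_def)
  define e where "e = restrict (\<lambda>r. \<iota> (P +> r)) (carrier (regular_module R))"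
  have coset: "P +> r \<in> carrier ?Q" if "r \<in> carrier R" for r
    using that unfolding carrier by blast
  have e_Hom: "e \<in> Hom R (regular_module R) E"
    unfolding e_def
  proof (rule HomI)
    fix r assume "r \<in> carrier (regular_module R)"
    then show "\<iota> (P +> r) \<in> carrier E" using Hom_closed[OF \<iota>(1) coset] by simp
  next
    fix r s assume "r \<in> carrier (regular_module R)" "s \<in> carrier (regular_module R)"
    then show "\<iota> (P +> (r \<oplus>\<^bsub>regular_module R\<^esub> s)) = \<iota> (P +> r) \<oplus>\<^bsub>E\<^esub> \<iota> (P +> s)"
      using Hom_add[OF \<iota>(1) coset coset] by (simp add: add)
  next
    fix r s assume "r \<in> carrier R" "s \<in> carrier (regular_module R)"
    then show "\<iota> (P +> (r \<odot>\<^bsub>regular_module R\<^esub> s)) = r \<odot>\<^bsub>E\<^esub> \<iota> (P +> s)"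
      using Hom_smult[OF \<iota>(1) _ coset] by (simp add: smult)
  qed (rule module_regular)
  have "e r = \<zero>\<^bsub>E\<^esub> \<longleftrightarrow> r \<in> P" if r: "r \<in> carrier R" for r
  proof -
    have "e \<zero> = \<zero>\<^bsub>E\<^esub>" using Hom_zero[OF module_regular E e_Hom] by simp
    then have "e r = \<zero>\<^bsub>E\<^esub> \<longleftrightarrow> P +> r = P +> \<zero>"
      using inj_on_eq_iff[OF \<iota>(2) coset[OF r] coset[OF zero_closed]] r by (simp add: e_def)
    also have "\<dots> \<longleftrightarrow> r \<in> P"
      using P.a_rcos_const[of r] P.a_rcos_const[of \<zero>] P.a_rcos_self[OF r] by auto
    finally show ?thesis .
  qed
  then have "module_ker (regular_module R) E e = P"
    using P.a_subset by (auto simp: module_ker_def)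
  moreover have "e ` carrier R = \<iota> ` carrier ?Q"
    unfolding carrier image_image by (intro image_cong) (simp_all add: e_def)
  ultimately show thesis using that e_Hom by blast
qed

lemma hom_orthogonal_injective_hull:
  fixes E :: "('a, 'e) module"
  assumes P: "P \<in> Spec R" and hull: "injective_hull R (quotient_module R P) E"
  shows "hom_orthogonal R E = {A \<in> mod_fp R. P \<notin> supp R A}"
proof -
  interpret P: primeideal P R using P by (simp add: Spec_def)
  have inj: "injective_module R E" using hull by (simp add: injective_hull_def)
  then have E: "module R E" by (simp add: injective_module_def)
  interpret E: module R E by fact
  obtain \<iota> where \<iota>: "\<iota> \<in> Hom R (quotient_module R P) E" "inj_on \<iota> (carrier (quotient_module R P))"
    and ess: "essential_submodule R (\<iota> ` carrier (quotient_module R P)) E"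
    using hull by (auto simp: injective_hull_def)
  obtain e where e: "e \<in> Hom R (regular_module R) E" and e_ker: "module_ker (regular_module R) E e = P"
    and e_image: "e ` carrier R = \<iota> ` carrier (quotient_module R P)"
    by (rule quotient_module_embedding[OF P.is_ideal E \<iota>])
  have e_zero: "e r = \<zero>\<^bsub>E\<^esub> \<longleftrightarrow> r \<in> P" if "r \<in> carrier R" for r
    using e_ker that by (auto simp: module_ker_def)
  have "Hom R A E = {zero_map A E} \<longleftrightarrow> P \<notin> supp R A" if "A \<in> mod_fp R" for A
  proof
    have A: "module R A" using that by (simp add: mod_fp_def finitely_presented_def)
    assume zero: "Hom R A E = {zero_map A E}"
    \<comment> \<open>the nonzero map from \<open>Rx\<close> through \<open>R/P\<close> to \<open>E\<close> extends to \<open>A\<close>\<close>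
    show "P \<notin> supp R A"
    proof
      assume "P \<in> supp R A"
      then obtain x where x: "x \<in> carrier A" "ann R A x \<subseteq> P" by (auto simp: supp_def)
      let ?C = "cyclic_module R (ann R A x)"
      note I = ideal_ann[OF A x(1)]
      obtain k where k: "k \<in> Hom R ?C A" "inj_on k (carrier ?C)"
        and k_map: "\<forall>r\<in>carrier R. k (cyclic_map R (ann R A x) r) = r \<odot>\<^bsub>A\<^esub> x"
        by (rule cyclic_embedding[OF A x(1)])
      obtain f where f: "f \<in> Hom R ?C E"
        and f_map: "\<forall>r\<in>carrier (regular_module R). f (cyclic_map R (ann R A x) r) = e r"
        by (rule Hom_factor[OF module_regular module_cyclic[OF I] E cyclic_map_Hom[OF I] _ e])
          (use x(2) in \<open>simp_all add: cyclic_map_surj[OF I] cyclic_map_ker[OF I] e_ker\<close>)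
      have "\<exists>h\<in>Hom R A E. \<forall>u\<in>carrier ?C. h (k u) = f u"
        using inj module_cyclic[OF I] A k f unfolding injective_module_def by blast
      then obtain h where h: "h \<in> Hom R A E" "\<And>u. u \<in> carrier ?C \<Longrightarrow> h (k u) = f u" by blast
      have "e \<one> = h (\<one> \<odot>\<^bsub>A\<^esub> x)"
        using h(2)[OF cyclic_map_closed[OF I one_closed]] k_map f_map by simp
      also have "\<dots> = \<zero>\<^bsub>E\<^esub>"
      proof -
        have "\<one> \<odot>\<^bsub>A\<^esub> x \<in> carrier A" using module.smult_closed[OF A one_closed x(1)] .
        moreover have "h = zero_map A E" using zero h(1) by blast
        ultimately show ?thesis by (simp add: zero_map_def)
      qed
      finally show False using e_zero[OF one_closed] P.one_imp_carrier P.I_notcarr by blast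
    qed
  next
    have A: "module R A" using that by (simp add: mod_fp_def finitely_presented_def)
    interpret A: module R A by fact
    assume supp: "P \<notin> supp R A"
    have "h = zero_map A E" if h: "h \<in> Hom R A E" for h
    proof (rule ccontr)
      assume "h \<noteq> zero_map A E"
      then obtain x where x: "x \<in> carrier A" "h x \<noteq> \<zero>\<^bsub>E\<^esub>"
        using extensionalityI[OF Hom_extensional[OF h], of "zero_map A E"]
        by (auto simp: zero_map_def)
      have hx: "h x \<in> carrier E" using Hom_closed[OF h x(1)] .
      let ?L = "(\<lambda>r. r \<odot>\<^bsub>E\<^esub> h x) ` carrier R"
      have "\<one> \<odot>\<^bsub>E\<^esub> h x \<in> ?L" by blast
      then have "?L \<noteq> {\<zero>\<^bsub>E\<^esub>}" using x(2) hx by auto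
      then have "?L \<inter> e ` carrier R \<noteq> {\<zero>\<^bsub>E\<^esub>}"
        using ess Hom_cyclic_submodule[OF E hx] unfolding essential_submodule_def e_image by blast
      moreover have "\<zero>\<^bsub>E\<^esub> \<in> ?L \<inter> e ` carrier R"
      proof
        show "\<zero>\<^bsub>E\<^esub> \<in> ?L" using hx by (intro image_eqI[of _ _ \<zero>]) auto
        show "\<zero>\<^bsub>E\<^esub> \<in> e ` carrier R" using e_zero[of \<zero>] by (intro image_eqI[of _ _ \<zero>]) auto
      qed
      \<comment> \<open>a nonzero multiple of \<open>h x\<close> in the image of \<open>R/P\<close>; its annihilator is \<open>P\<close>\<close>
      ultimately obtain y where y: "y \<noteq> \<zero>\<^bsub>E\<^esub>" "y \<in> ?L" "y \<in> e ` carrier R" by blast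
      then obtain r s where r: "r \<in> carrier R" "y = r \<odot>\<^bsub>E\<^esub> h x" and s: "s \<in> carrier R" "y = e s"
        by blast
      have "s \<notin> P" using y(1) s e_zero by blast
      have "ann R A (r \<odot>\<^bsub>A\<^esub> x) \<subseteq> P"
      proof
        fix t assume "t \<in> ann R A (r \<odot>\<^bsub>A\<^esub> x)"
        then have t: "t \<in> carrier R" "t \<odot>\<^bsub>A\<^esub> (r \<odot>\<^bsub>A\<^esub> x) = \<zero>\<^bsub>A\<^esub>" by (auto simp: ann_def)
        have "e (t \<otimes> s) = t \<odot>\<^bsub>E\<^esub> y" using Hom_smult[OF e t(1), of s] s by simp
        also have "\<dots> = h (t \<odot>\<^bsub>A\<^esub> (r \<odot>\<^bsub>A\<^esub> x))"
          using Hom_smult[OF h] r t(1) x(1) by simp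
        also have "\<dots> = \<zero>\<^bsub>E\<^esub>" using t(2) Hom_zero[OF A E h] by simp
        finally have "t \<otimes> s \<in> P" using e_zero t(1) s(1) by simp
        then show "t \<in> P" using P.I_prime[OF t(1) s(1)] \<open>s \<notin> P\<close> by blast
      qed
      moreover have "r \<odot>\<^bsub>A\<^esub> x \<in> carrier A" using r(1) x(1) by simp
      ultimately show False using supp P unfolding supp_def by blast
    qed
    moreover have "zero_map A E \<in> Hom R A E"
      unfolding zero_map_def by (rule HomI) (auto simp: A)
    ultimately show "Hom R A E = {zero_map A E}" by blast
  qed
  then show ?thesis unfolding hom_orthogonal_def by blast
qed

lemma supp_upward:
  assumes "P \<in> supp R M" "Q \<in> Spec R" "P \<subseteq> Q"
  shows "Q \<in> supp R M"
  using assms by (auto simp: supp_def)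

lemma mem_closure_zariski_iff:
  assumes P: "P \<in> Spec R" and Q: "Q \<in> Spec R"
  shows "P \<in> zariski R closure_of {Q} \<longleftrightarrow> Q \<subseteq> P"
proof -
  have carrier: "P \<subseteq> carrier R" "Q \<subseteq> carrier R" "\<not> carrier R \<subseteq> P"
  proof -
    interpret P: primeideal P R using P by (simp add: Spec_def)
    interpret Q: primeideal Q R using Q by (simp add: Spec_def)
    show "P \<subseteq> carrier R" "Q \<subseteq> carrier R" "\<not> carrier R \<subseteq> P"
      using P.a_subset Q.a_subset P.I_notcarr by blast+
  qed
  have closure: "P \<in> zariski R closure_of {Q} \<longleftrightarrow>
      P \<in> topspace (zariski R) \<and> (\<forall>U. P \<in> U \<and> openin (zariski R) U \<longrightarrow> Q \<in> U)"
    unfolding in_closure_of by simp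
  have "openin (zariski R) {P \<in> Spec R. \<not> carrier R \<subseteq> P}" unfolding openin_zariski by blast
  then have "{P \<in> Spec R. \<not> carrier R \<subseteq> P} \<subseteq> topspace (zariski R)" by (rule openin_subset)
  then have top: "P \<in> topspace (zariski R)" using P carrier by blast
  show ?thesis
  proof
    assume cl: "P \<in> zariski R closure_of {Q}"
    show "Q \<subseteq> P"
    proof (rule ccontr)
      assume "\<not> Q \<subseteq> P"
      then have "P \<in> {P \<in> Spec R. \<not> Q \<subseteq> P}" using P by blast
      moreover have "openin (zariski R) {P \<in> Spec R. \<not> Q \<subseteq> P}"
        unfolding openin_zariski using carrier by blast
      ultimately have "Q \<in> {P \<in> Spec R. \<not> Q \<subseteq> P}" using cl unfolding closure by (metis (lifting))
      then show False by simp
    qed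
  next
    assume QP: "Q \<subseteq> P"
    have "Q \<in> U" if "P \<in> U" "openin (zariski R) U" for U
    proof -
      obtain X where "U = {P \<in> Spec R. \<not> X \<subseteq> P}"
        using \<open>openin (zariski R) U\<close> unfolding openin_zariski by blast
      then show ?thesis using \<open>P \<in> U\<close> Q QP by blast
    qed
    then show "P \<in> zariski R closure_of {Q}" using top unfolding closure by simp
  qed
qed

end

section \<open>The prime Serre subcategories\<close>

context noetherian_cring
begin

lemma Spec_ideal: "P \<in> Spec R \<Longrightarrow> ideal P R"
  by (simp add: Spec_def primeideal.axioms(1))

lemma avoiding_subset_iff:
  assumes P: "P \<in> Spec R" and Q: "Q \<in> Spec R"
  shows "{A \<in> mod_fp R. Q \<notin> supp R A} \<subseteq> {A \<in> mod_fp R. P \<notin> supp R A} \<longleftrightarrow> P \<subseteq> Q"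
proof
  assume "{A \<in> mod_fp R. Q \<notin> supp R A} \<subseteq> {A \<in> mod_fp R. P \<notin> supp R A}"
  moreover have "cyclic_module R P \<in> mod_fp R" "P \<in> supp R (cyclic_module R P)"
    using P by (simp_all add: cyclic_mod_fp supp_cyclic Spec_ideal)
  ultimately have "Q \<in> supp R (cyclic_module R P)" by blast
  then show "P \<subseteq> Q" using supp_cyclic[OF Spec_ideal[OF P]] by blast
next
  assume "P \<subseteq> Q"
  then show "{A \<in> mod_fp R. Q \<notin> supp R A} \<subseteq> {A \<in> mod_fp R. P \<notin> supp R A}"
    using supp_upward[OF _ Q] by blast
qed

lemma avoiding_in_Sp:
  assumes P: "P \<in> Spec R"
  shows "{A \<in> mod_fp R. P \<notin> supp R A} \<in> Sp R"
proof -
  have cyclic: "cyclic_module R P \<in> mod_fp R" "P \<in> supp R (cyclic_module R P)"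
    using P by (simp_all add: cyclic_mod_fp supp_cyclic Spec_ideal)
  have "serre_subcategory R {A \<in> mod_fp R. P \<notin> supp R A}"
    using serre_avoiding_supports[of "{P}"] by simp
  moreover have "{A \<in> mod_fp R. P \<notin> supp R A} \<noteq> mod_fp R" using cyclic by blast
  moreover have "S1 \<subseteq> {A \<in> mod_fp R. P \<notin> supp R A} \<or> S2 \<subseteq> {A \<in> mod_fp R. P \<notin> supp R A}"
    if "S1 \<in> Ser R" "S2 \<in> Ser R" and Int: "S1 \<inter> S2 \<subseteq> {A \<in> mod_fp R. P \<notin> supp R A}" for S1 S2
  proof -
    have S: "serre_subcategory R S1" "serre_subcategory R S2" using that by (simp_all add: Ser_def)
    have "cyclic_module R P \<notin> S1 \<or> cyclic_module R P \<notin> S2" using Int cyclic by blast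
    moreover have "S \<subseteq> {A \<in> mod_fp R. P \<notin> supp R A}"
      if "serre_subcategory R S" "cyclic_module R P \<notin> S" for S
      using serre_iff_primes_of_supp[OF that(1)] that(2) by blast
    ultimately show ?thesis using S by blast
  qed
  ultimately show ?thesis unfolding Sp_def Ser_def by blast
qed

text \<open>
  \<open>V I\<close> in the proof is the Serre subcategory of the modules supported on the primes containing \<open>I\<close>.
\<close>

lemma Sp_primes_directed:
  assumes S: "S \<in> Sp R" and P: "P \<in> Spec R" "cyclic_module R P \<notin> S"
    and Q: "Q \<in> Spec R" "cyclic_module R Q \<notin> S"
  obtains N where "N \<in> Spec R" "cyclic_module R N \<notin> S" "P \<subseteq> N" "Q \<subseteq> N"
proof -
  define V where "V I = {A \<in> mod_fp R. supp R A \<inter> {N. \<not> I \<subseteq> N} = {}}" for I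
  have V: "V I \<in> Ser R" for I unfolding V_def Ser_def using serre_avoiding_supports by blast
  have cyclic: "cyclic_module R I \<in> V I" if "I \<in> Spec R" for I
    using that unfolding V_def by (auto simp: cyclic_mod_fp supp_cyclic Spec_ideal)
  have serre: "serre_subcategory R S" using S by (simp add: Sp_def Ser_def)
  have "\<not> V P \<subseteq> S" "\<not> V Q \<subseteq> S" using cyclic P Q by blast+
  then have "\<not> V P \<inter> V Q \<subseteq> S" using S V unfolding Sp_def by blast
  then obtain A where A: "A \<in> V P" "A \<in> V Q" "A \<notin> S" by blast
  then have "A \<in> mod_fp R" by (simp add: V_def)
  then obtain N where N: "N \<in> supp R A" "cyclic_module R N \<notin> S"
    using serre_iff_primes_of_supp[OF serre] A(3) by blast
  then have "P \<subseteq> N" "Q \<subseteq> N" using A(1,2) unfolding V_def by blast+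
  moreover have "N \<in> Spec R" using N(1) by (simp add: supp_def)
  ultimately show thesis using that N(2) by blast
qed

lemma Sp_is_avoiding:
  assumes S: "S \<in> Sp R"
  obtains P where "P \<in> Spec R" "S = {A \<in> mod_fp R. P \<notin> supp R A}"
proof -
  have serre: "serre_subcategory R S" and "S \<noteq> mod_fp R" using S by (simp_all add: Sp_def Ser_def)
  then obtain A where "A \<in> mod_fp R" "A \<notin> S" using serre_subset by blast
  then obtain P where P: "P \<in> supp R A" "cyclic_module R P \<notin> S"
    using serre_iff_primes_of_supp[OF serre] by blast
  \<comment> \<open>\<open>T\<close> is directed and satisfies the ascending chain condition, hence has a greatest element\<close>
  let ?T = "{Q \<in> Spec R. cyclic_module R Q \<notin> S}"
  have "P \<in> ?T" using P by (simp add: supp_def)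
  then obtain M where M: "M \<in> ?T" and max: "\<And>J. \<lbrakk>J \<in> ?T; M \<subseteq> J\<rbrakk> \<Longrightarrow> J = M"
    by (rule exists_maximal_ideal_in[of P ?T]) (auto intro: Spec_ideal)
  have greatest: "Q \<subseteq> M" if Q: "Q \<in> ?T" for Q
  proof -
    obtain N where N: "N \<in> Spec R" "cyclic_module R N \<notin> S" "Q \<subseteq> N" "M \<subseteq> N"
      by (rule Sp_primes_directed[OF S, of Q M]) (use Q M in auto)
    then have "N = M" using max[of N] by blast
    then show ?thesis using N(3) by simp
  qed
  have "B \<in> S \<longleftrightarrow> B \<in> mod_fp R \<and> M \<notin> supp R B" for B
  proof
    assume "B \<in> S"
    then show "B \<in> mod_fp R \<and> M \<notin> supp R B"
      using serre_iff_primes_of_supp[OF serre, of B] M by blast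
  next
    assume B: "B \<in> mod_fp R \<and> M \<notin> supp R B"
    have "cyclic_module R Q \<in> S" if Q: "Q \<in> supp R B" for Q
    proof (rule ccontr)
      assume "cyclic_module R Q \<notin> S"
      then have "Q \<subseteq> M" using greatest[of Q] Q by (simp add: supp_def)
      then show False using supp_upward[OF Q] M B by blast
    qed
    then show "B \<in> S" using serre_iff_primes_of_supp[OF serre, of B] B by blast
  qed
  then have "S = {A \<in> mod_fp R. M \<notin> supp R A}" by blast
  then show thesis using that M by blast
qed

end

theorem proposition2p9:
  fixes R :: "('a, 'r) ring_scheme"
    and E :: "'a set \<Rightarrow> ('a, 'e) module"
  assumes "cring R" and "noetherian_ring R"
    and "\<And>P. P \<in> Spec R \<Longrightarrow> injective_hull R (quotient_module R P) (E P)"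
  shows "bij_betw (\<lambda>P. hom_orthogonal R (E P)) (Spec R) (Sp R) \<and>
    (\<forall>P \<in> Spec R. \<forall>Q \<in> Spec R.
       P \<subseteq> Q \<longleftrightarrow> hom_orthogonal R (E Q) \<subseteq> hom_orthogonal R (E P)) \<and>
    (\<forall>P \<in> Spec R. \<forall>Q \<in> Spec R.
       P \<in> (zariski R) closure_of {Q} \<longleftrightarrow> hom_orthogonal R (E P) \<subseteq> hom_orthogonal R (E Q))"
proof -
  interpret noetherian_cring R using assms(1,2) by (rule noetherian_cring.intro)
  have orth: "hom_orthogonal R (E P) = {A \<in> mod_fp R. P \<notin> supp R A}" if "P \<in> Spec R" for P
    using hom_orthogonal_injective_hull[OF that assms(3)[OF that]] .
  have order: "hom_orthogonal R (E Q) \<subseteq> hom_orthogonal R (E P) \<longleftrightarrow> P \<subseteq> Q"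
    if "P \<in> Spec R" "Q \<in> Spec R" for P Q
    using avoiding_subset_iff[OF that] orth that by simp
  have "bij_betw (\<lambda>P. hom_orthogonal R (E P)) (Spec R) (Sp R)"
  proof (rule bij_betw_imageI)
    show "inj_on (\<lambda>P. hom_orthogonal R (E P)) (Spec R)"
    proof (rule inj_onI)
      fix P Q assume "P \<in> Spec R" "Q \<in> Spec R" "hom_orthogonal R (E P) = hom_orthogonal R (E Q)"
      then show "P = Q" using order[of P Q] order[of Q P] by simp
    qed
    show "(\<lambda>P. hom_orthogonal R (E P)) ` Spec R = Sp R"
    proof
      show "(\<lambda>P. hom_orthogonal R (E P)) ` Spec R \<subseteq> Sp R"
        using avoiding_in_Sp orth by (intro image_subsetI) simp
      show "Sp R \<subseteq> (\<lambda>P. hom_orthogonal R (E P)) ` Spec R"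
      proof
        fix S assume "S \<in> Sp R"
        then obtain P where "P \<in> Spec R" "S = {A \<in> mod_fp R. P \<notin> supp R A}"
          by (rule Sp_is_avoiding)
        then show "S \<in> (\<lambda>P. hom_orthogonal R (E P)) ` Spec R" using orth by (intro image_eqI) simp_all
      qed
    qed
  qed
  then show ?thesis using order mem_closure_zariski_iff by simp
qed

end
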